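(* Let $G \in \mathcal{F}_n$, and let $H_1$ and $H_2$ be graphs that are generalized cospectral to $G$. Let $Q_1$ and $Q_2$ be the rational orthogonal matrices satisfying $Q_i^{\mathrm{T}} A(G) Q_i = A(H_i)$ and $Q_i e = e$ for $i=1,2$. If $\ell(Q_1) = \ell(Q_2)$, then $H_1 \cong H_2$ (that is, $H_1$ and $H_2$ are isomorphic).
   Context: All graphs are simple (finite, undirected, no loops or multiple edges). For a graph $G$ on $n$ vertices, $A(G)$ is its adjacency matrix, and $\overline{G}$ is its complement. $\operatorname{Spec}(G)$ is the multiset of eigenvalues of $A(G)$. The generalized spectrum of $G$ is the pair $(\operatorname{Spec}(G), \operatorname{Spec}(\overline{G}))$; two graphs are generalized cospectral if they have the same generalized spectrum. $e$ denotes the all-ones column vector of length $n$. The walk matrix $W(G)$ is the $n\times n$ matrix with columns $e, A(G)e, \dots, A(G)^{n-1}e$. $G$ is controllable if $W(G)$ is non-singular. For a full-rank integral $n \times n$ matrix $M$, $d_1(M)\mid d_2(M)\mid\cdots\mid d_n(M)$ denote the (positive) invariant factors of its Smith Normal Form. $\mathcal{F}_n$ is the family of controllable graphs $G$ on $n$ vertices with $d_{\lceil n/2\rceil}(W(G)) = 1$ and $d_{n-1}(W(G)) = 2$. The level $\ell(Q)$ of a rational matrix $Q$ is the smallest positive integer $x$ such that $xQ$ is an integral matrix. It is a known fact (Wang–Xu) that if $G$ is controllable and $H$ is generalized cospectral to $G$, then $H$ is controllable and there exists a unique rational orthogonal matrix $Q$ with $Qe=e$ and $Q^{\mathrm{T}}A(G)Q=A(H)$;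 moreover $Q = W(G)W(H)^{-1}$. *)

theory Defs
  imports
    "Jordan_Normal_Form.Char_Poly"
    "Graph_Theory.Pair_Digraph"
    "Graph_Theory.Digraph_Isomorphism"
    "HOL.Complex"
begin

(* A simple graph is a finite, loopless, symmetric digraph without parallel arcs, with each
   edge uv stored as the two arcs (u,v) and (v,u). The n vertices are labelled 0, ..., n-1,
   so that they index the rows and columns of the matrices below. *)
definition simple_graph :: "nat pair_pre_digraph \<Rightarrow> bool" where
  "simple_graph G \<longleftrightarrow> pair_graph G \<and> pverts G = {0..<card (pverts G)}"

abbreviation num_verts :: "nat pair_pre_digraph \<Rightarrow> nat" where
  "num_verts G \<equiv> card (pverts G)"

definition graph_complement :: "nat pair_pre_digraph \<Rightarrow> nat pair_pre_digraph" where
  "graph_complement G = \<lparr> pverts = pverts G,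
     parcs = {(u, v). u \<in> pverts G \<and> v \<in> pverts G \<and> u \<noteq> v \<and> (u, v) \<notin> parcs G} \<rparr>"

definition adjacency_mat :: "nat pair_pre_digraph \<Rightarrow> 'a :: zero_neq_one mat" where
  "adjacency_mat G = mat (num_verts G) (num_verts G) (\<lambda>(i, j). of_bool ((i, j) \<in> parcs G))"

(* Eigenvalues are counted with algebraic multiplicity, over the complex numbers, so that
   none is lost; for a simple graph they are all real. *)
definition spec :: "nat pair_pre_digraph \<Rightarrow> complex multiset" where
  "spec G = proots (char_poly (adjacency_mat G))"

definition generalized_spectrum ::
    "nat pair_pre_digraph \<Rightarrow> complex multiset \<times> complex multiset" where
  "generalized_spectrum G = (spec G, spec (graph_complement G))"

definition generalized_cospectral ::
    "nat pair_pre_digraph \<Rightarrow> nat pair_pre_digraph \<Rightarrow> bool" where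
  "generalized_cospectral G H \<longleftrightarrow> generalized_spectrum G = generalized_spectrum H"

definition all_ones :: "nat \<Rightarrow> 'a :: one vec" where
  "all_ones n = vec n (\<lambda>_. 1)"

definition walk_mat :: "nat pair_pre_digraph \<Rightarrow> int mat" where
  "walk_mat G = mat_of_cols (num_verts G)
     (map (\<lambda>k. (adjacency_mat G ^\<^sub>m k) *\<^sub>v all_ones (num_verts G)) [0..<num_verts G])"

definition controllable :: "nat pair_pre_digraph \<Rightarrow> bool" where
  "controllable G \<longleftrightarrow> det (walk_mat G) \<noteq> 0"

(* d 1, ..., d n are the invariant factors of the full-rank n x n integer matrix M, i.e.
   M has Smith normal form diag (d 1, ..., d n); they are determined by M.
   "invertible_mat" refers to invertibility over the integers. *)
definition invariant_factors :: "nat \<Rightarrow> int mat \<Rightarrow> (nat \<Rightarrow> int) \<Rightarrow> bool" where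
  "invariant_factors n M d \<longleftrightarrow> M \<in> carrier_mat n n \<and>
     (\<forall>k \<in> {1..n}. 0 < d k) \<and>
     (\<forall>k \<in> {1..<n}. d k dvd d (Suc k)) \<and>
     (\<exists>U \<in> carrier_mat n n. \<exists>V \<in> carrier_mat n n. invertible_mat U \<and> invertible_mat V \<and>
        U * M * V = mat_diag n (\<lambda>i. d (Suc i)))"

(* The condition 2 \<le> n only makes sure that the index n - 1 lies in {1..n}. *)
definition graph_family :: "nat \<Rightarrow> nat pair_pre_digraph set" where
  "graph_family n = {G. simple_graph G \<and> num_verts G = n \<and> 2 \<le> n \<and> controllable G \<and>
     (\<exists>d. invariant_factors n (walk_mat G) d \<and> d (nat \<lceil>real n / 2\<rceil>) = 1 \<and> d (n - 1) = 2)}"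

(* Orthogonal in the usual sense. The predicate orthogonal_mat of Jordan_Normal_Form is weaker:
   it does not ask the columns to have norm 1. *)
definition orthonormal_mat :: "'a :: semiring_1 mat \<Rightarrow> bool" where
  "orthonormal_mat Q \<longleftrightarrow> square_mat Q \<and> transpose_mat Q * Q = 1\<^sub>m (dim_row Q)"

definition level :: "rat mat \<Rightarrow> nat" where
  "level Q = (LEAST x. 0 < x \<and> elements_mat (of_nat x \<cdot>\<^sub>m Q) \<subseteq> \<int>)"

end

theory Submission
  imports Defs "HOL-Library.Function_Algebras"
begin

text \<open>Let \<open>A\<close> be the adjacency matrix of \<open>G\<close>, \<open>L\<^sub>0\<close> the lattice of integral vectors and \<open>L\<^sub>i\<close> the
  lattice spanned by the columns of \<open>Q\<^sub>i\<close>. All three are unimodular, stable under \<open>A\<close>, and have the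
  all-ones vector \<open>e\<close> as a characteristic vector. If \<open>L\<^sub>1 = L\<^sub>2\<close>, then \<open>Q\<^sub>1\<^sup>T Q\<^sub>2\<close> is an integral
  orthogonal matrix fixing \<open>e\<close>, i.e. a permutation matrix.

  Every \<open>L\<^sub>i\<close> pairs integrally with the walk vectors \<open>A\<^sup>j e\<close>, so \<open>C\<^sub>i = L\<^sub>i / (L\<^sub>i \<inter> L\<^sub>0)\<close> embeds into the
  cokernel of the walk matrix, whose Smith normal form makes \<open>2 C\<^sub>i\<close> cyclic. An element of order 2 of
  \<open>C\<^sub>i\<close> is half of an integral vector \<open>z\<close> with \<open>z\<^sup>T A\<^sup>j z\<close> divisible by 4 for all \<open>j\<close>. Modulo 2 such a \<open>z\<close> is
  \<open>c(A) e'\<close> for a polynomial \<open>c\<close>, where \<open>e' = e\<close> or \<open>e' = A e\<close>, and the condition becomes that \<open>c\<^sup>2\<close> lies in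
  an ideal of \<open>F\<^sub>2[x]\<close>. As at most one invariant factor is divisible by 4, at most one nonzero \<open>z\<close> exists,
  and therefore \<open>C\<^sub>i\<close> is cyclic. A refinement of the same argument shows that \<open>C\<^sub>1\<close> and \<open>C\<^sub>2\<close>
  coincide if the levels do. Finally a lattice \<open>L\<close> with cyclic \<open>L / (L \<inter> L\<^sub>0)\<close> is recovered from
  \<open>L + L\<^sub>0\<close>, because \<open>(x\<^sup>T x - x\<^sup>T e) / 2\<close> is integral on \<open>L\<close> and on \<open>L\<^sub>0\<close>.\<close>

subsection \<open>Integer polynomials modulo 2\<close>

lemma two_dvd_poly_iff: "2 dvd p \<longleftrightarrow> (\<forall>i. even (coeff p i))" for p :: "int poly"
  by (simp add: numeral_poly const_poly_dvd_iff)

lemma prime_elem_two_poly: "prime_elem (2 :: int poly)"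
  by (simp add: numeral_poly prime_elem_const_poly_iff)

lemma two_not_dvd_monic: "lead_coeff p = 1 \<Longrightarrow> \<not> 2 dvd p" for p :: "int poly"
  by (metis odd_one two_dvd_poly_iff)

lemma monic_cong_mod_two:
  fixes p :: "int poly"
  assumes "\<not> 2 dvd p"
  obtains q where "lead_coeff q = 1" "degree q \<le> degree p" "2 dvd p - q"
proof -
  have "\<exists>q. lead_coeff q = 1 \<and> degree q \<le> degree p \<and> 2 dvd p - q"
    using assms
  proof (induction "degree p" arbitrary: p rule: less_induct)
    case less
    define r where "r = p - monom (lead_coeff p) (degree p)"
    have lc: "2 dvd monom (lead_coeff p) (degree p)" if "even (lead_coeff p)"
      using that by (auto simp: two_dvd_poly_iff coeff_monom)
    show ?case
    proof (cases "even (lead_coeff p)")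
      case True
      have nr: "\<not> 2 dvd r"
        using less.prems lc[OF True] by (metis r_def diff_add_cancel dvd_add)
      have "degree p \<noteq> 0"
      proof
        assume "degree p = 0"
        hence "even (coeff p i)" for i using True coeff_eq_0[of p i] by (cases "i = 0") auto
        thus False using less.prems by (simp add: two_dvd_poly_iff)
      qed
      moreover have "degree r \<le> degree p"
        unfolding r_def by (rule degree_diff_le) (simp_all add: degree_monom_le)
      moreover have "coeff r (degree p) = 0" by (simp add: r_def)
      ultimately have "degree r < degree p"
        by (metis le_neq_implies_less leading_coeff_0_iff degree_0)
      from less.hyps[OF this nr] obtain q
        where q: "lead_coeff q = 1" "degree q \<le> degree r" "2 dvd r - q" by blast
      have "p - q = (r - q) + monom (lead_coeff p) (degree p)" by (simp add: r_def)
      hence "2 dvd p - q" using q(3) lc[OF True] by (metis dvd_add)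
      with q \<open>degree r < degree p\<close> show ?thesis by force
    next
      case False
      define q where "q = p - monom (lead_coeff p - 1) (degree p)"
      have "degree q \<le> degree p"
        unfolding q_def by (rule degree_diff_le) (simp_all add: degree_monom_le)
      moreover have c: "coeff q (degree p) = 1" by (simp add: q_def)
      ultimately have "degree q = degree p" by (simp add: le_antisym le_degree)
      with c have "lead_coeff q = 1" by simp
      moreover have "2 dvd p - q"
        using False by (auto simp: q_def two_dvd_poly_iff coeff_monom)
      ultimately show ?thesis using \<open>degree q = degree p\<close> by (intro exI[of _ q]) auto
    qed
  qed
  thus ?thesis using that by blast
qed

text \<open>Canonical representatives of polynomials modulo 2, indexed by sets so that counting them
  becomes counting a power set.\<close>

definition zero_one_poly :: "nat set \<Rightarrow> int poly" where
  "zero_one_poly S = (\<Sum>i\<in>S. monom 1 i)"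

lemma coeff_zero_one_poly: "finite S \<Longrightarrow> coeff (zero_one_poly S) i = of_bool (i \<in> S)"
  by (simp add: zero_one_poly_def coeff_sum coeff_monom sum.delta')

lemma degree_zero_one_poly:
  assumes "S \<subseteq> {..<k}" "0 < k"
  shows "degree (zero_one_poly S) < k"
proof -
  have "finite S" using assms(1) finite_subset by blast
  hence "coeff (zero_one_poly S) i = 0" if "i > k - 1" for i
    using that assms by (auto simp: coeff_zero_one_poly)
  hence "degree (zero_one_poly S) \<le> k - 1" using degree_le by blast
  thus ?thesis using assms(2) by simp
qed

lemma zero_one_poly_cong_imp_eq:
  assumes "finite S" "finite S'" "2 dvd zero_one_poly S - zero_one_poly S'"
  shows "S = S'"
proof -
  have "even (of_bool (i \<in> S) - of_bool (i \<in> S') :: int)" for i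
    using assms unfolding two_dvd_poly_iff coeff_diff by (simp add: coeff_zero_one_poly)
  hence "i \<in> S \<longleftrightarrow> i \<in> S'" for i
    by (metis of_bool_eq(1,2) diff_zero diff_0 even_minus odd_one)
  thus ?thesis by blast
qed

lemma half_Ints_iff_even: "(of_int k :: rat) / 2 \<in> \<int> \<longleftrightarrow> even k"
proof
  assume "(of_int k :: rat) / 2 \<in> \<int>"
  then obtain l where "(of_int k :: rat) / 2 = of_int l" by (rule Ints_cases)
  hence "(of_int k :: rat) = of_int (2 * l)" by simp
  hence "k = 2 * l" by (simp only: of_int_eq_iff)
  thus "even k" by simp
qed auto

lemma int_subgroup_generator:
  fixes K :: "int set"
  assumes add: "\<And>x y. x \<in> K \<Longrightarrow> y \<in> K \<Longrightarrow> x + y \<in> K" and scale: "\<And>a x. x \<in> K \<Longrightarrow> a * x \<in> K"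
    and d: "d \<in> K" "0 < d"
  obtains r where "r \<in> K" "0 < r" "\<And>x. x \<in> K \<Longrightarrow> r dvd x"
proof -
  define m where "m = (LEAST m :: nat. 0 < m \<and> int m \<in> K)"
  have ex: "0 < nat d \<and> int (nat d) \<in> K" using d by simp
  have m: "0 < m" "int m \<in> K" using LeastI[where P = "\<lambda>m. 0 < m \<and> int m \<in> K", OF ex] by (auto simp: m_def)
  have "int m dvd x" if "x \<in> K" for x
  proof -
    have "x mod int m = x + - (x div int m) * int m" by (simp add: minus_div_mult_eq_mod)
    hence "x mod int m \<in> K" using add scale that m by metis
    moreover have "0 \<le> x mod int m" "x mod int m < int m" using m by simp_all
    moreover have "\<not> (0 < k \<and> int k \<in> K)" if "k < m" for k
      using not_less_Least[of k "\<lambda>m. 0 < m \<and> int m \<in> K"] that by (simp add: m_def)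
    from this[of "nat (x mod int m)"] have "\<not> (0 < x mod int m \<and> x mod int m \<in> K)"
      using \<open>0 \<le> x mod int m\<close> \<open>x mod int m < int m\<close> by auto
    ultimately have "x mod int m = 0" by linarith
    thus ?thesis by blast
  qed
  with m show ?thesis by (intro that[of "int m"]) auto
qed

subsection \<open>Unimodular lattices stable under a self-adjoint map\<close>

text \<open>The form is rational-valued because different lattices are compared inside one ambient
  module. It may be degenerate. The vector \<open>e\<close> gets its meaning only through
  \<open>char_lattice\<close>.\<close>

locale self_adjoint_module = Modules.module scale
  for scale :: "int \<Rightarrow> 'v::ab_group_add \<Rightarrow> 'v" (infixr "*s" 75) +
  fixes B :: "'v \<Rightarrow> 'v \<Rightarrow> rat" and T :: "'v \<Rightarrow> 'v" and e :: 'v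
  assumes B_add_left: "B (x + y) z = B x z + B y z"
    and B_scale_left: "B (a *s x) z = of_int a * B x z"
    and B_sym: "B x y = B y x"
    and T_add: "T (x + y) = T x + T y"
    and T_scale: "T (a *s x) = a *s T x"
    and T_adjoint: "B (T x) y = B x (T y)"
begin

lemma B_add_right: "B z (x + y) = B z x + B z y"
  by (metis B_add_left B_sym)

lemma B_scale_right: "B z (a *s x) = of_int a * B z x"
  by (metis B_scale_left B_sym)

lemma B_zero_left [simp]: "B 0 z = 0"
  using B_add_left[of 0 0 z] by simp

lemma B_zero_right [simp]: "B z 0 = 0"
  using B_sym[of z 0] by simp

lemma B_diff_left: "B (x - y) z = B x z - B y z"
  using B_add_left[of "x - y" y z] by simp

lemma B_diff_right: "B z (x - y) = B z x - B z y"
  by (metis B_diff_left B_sym)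

lemmas B_simps = B_add_left B_add_right B_diff_left B_diff_right B_scale_left B_scale_right

lemma T_zero [simp]: "T 0 = 0"
  using T_add[of 0 0] by simp

lemma T_diff: "T (x - y) = T x - T y"
  using T_add[of "x - y" y] by simp

lemma T_funpow_adjoint: "B ((T ^^ j) x) y = B x ((T ^^ j) y)"
  by (induction j arbitrary: y) (simp_all add: T_adjoint funpow_swap1[symmetric])

text \<open>Horner evaluation of \<open>p\<close> at the operator \<open>T\<close>, applied to
  \<open>x\<close>.\<close>

definition act :: "int poly \<Rightarrow> 'v \<Rightarrow> 'v" where
  "act p x = fold_coeffs (\<lambda>a y. a *s x + T y) p 0"

lemma act_0 [simp]: "act 0 x = 0"
  by (simp add: act_def)

lemma act_pCons [simp]: "act (pCons a p) x = a *s x + T (act p x)"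
  by (cases "a = 0 \<and> p = 0") (auto simp: act_def)

lemma act_1 [simp]: "act 1 x = x"
  by (simp add: one_pCons)

lemma act_add: "act (p + q) x = act p x + act q x"
  by (induction p q rule: poly_induct2) (simp_all add: scale_left_distrib T_add algebra_simps)

lemma act_smult: "act (Polynomial.smult a p) x = a *s act p x"
  by (induction p) (simp_all add: scale_right_distrib T_scale)

lemma act_diff: "act (p - q) x = act p x - act q x"
  using act_add[of "p - q" q x] by simp

lemma act_add_right: "act p (x + y) = act p x + act p y"
  by (induction p) (simp_all add: scale_right_distrib T_add algebra_simps)

lemma act_scale_right: "act p (a *s x) = a *s act p x"
  by (induction p) (simp_all add: scale_right_distrib T_scale mult.commute)

lemma act_zero_right [simp]: "act p 0 = 0"
  by (induction p) simp_all

lemma act_diff_right: "act p (x - y) = act p x - act p y"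
  using act_add_right[of p "x - y" y] by simp

lemma act_T: "act p (T x) = T (act p x)"
  by (induction p) (simp_all add: T_add T_scale)

lemma act_mult: "act (p * q) x = act p (act q x)"
  by (induction p) (simp_all add: act_add act_smult)

lemma act_monom: "act (monom 1 j) x = (T ^^ j) x"
  by (induction j) (simp_all add: monom_Suc monom_0)

lemma act_2 [simp]: "act (2 * p) x = 2 *s act p x"
  by (metis act_smult numeral_mult_conv_smult)

lemma act_adjoint: "B (act p x) y = B x (act p y)"
  by (induction p arbitrary: y) (simp_all add: B_simps T_adjoint act_T)

lemma act_sum: "act (sum f S) x = (\<Sum>k\<in>S. act (f k) x)"
  by (induction S rule: infinite_finite_induct) (simp_all add: act_add)

lemma act_eq_sum:
  assumes "degree p < n"
  shows "act p x = (\<Sum>k<n. coeff p k *s (T ^^ k) x)"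
proof -
  have "p = (\<Sum>k<n. Polynomial.smult (coeff p k) (monom 1 k))"
    using poly_as_sum_of_monoms'[of p "n - 1"] assms
    by (cases n) (simp_all add: smult_monom lessThan_Suc_atMost)
  hence "act p x = (\<Sum>k<n. act (Polynomial.smult (coeff p k) (monom 1 k)) x)"
    by (metis act_sum)
  thus ?thesis by (simp add: act_smult act_monom)
qed

text \<open>The first condition is self-duality, which already makes \<open>L\<close> a subgroup.
  The last one abstracts a symmetric integral matrix with zero diagonal.\<close>

definition char_lattice :: "'v set \<Rightarrow> bool" where
  "char_lattice L \<longleftrightarrow> (\<forall>x. x \<in> L \<longleftrightarrow> (\<forall>y\<in>L. B x y \<in> \<int>)) \<and> (\<forall>x\<in>L. T x \<in> L) \<and> e \<in> L \<and>
     (\<forall>x\<in>L. (B x x - B x e) / 2 \<in> \<int>) \<and> (\<forall>x\<in>L. B (T x) x / 2 \<in> \<int>)"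

context
  fixes L assumes L: "char_lattice L"
begin

lemma lattice_dual: "x \<in> L \<longleftrightarrow> (\<forall>y\<in>L. B x y \<in> \<int>)"
  using L unfolding char_lattice_def by blast

lemma lattice_int: "x \<in> L \<Longrightarrow> y \<in> L \<Longrightarrow> B x y \<in> \<int>"
  using lattice_dual by blast

lemma lattice_zero: "0 \<in> L"
  by (subst lattice_dual) simp

lemma lattice_add: "x \<in> L \<Longrightarrow> y \<in> L \<Longrightarrow> x + y \<in> L"
  by (subst lattice_dual) (simp add: B_simps lattice_int)

lemma lattice_diff: "x \<in> L \<Longrightarrow> y \<in> L \<Longrightarrow> x - y \<in> L"
  by (subst lattice_dual) (simp add: B_simps lattice_int)

lemma lattice_scale: "x \<in> L \<Longrightarrow> a *s x \<in> L"
  by (subst lattice_dual) (simp add: B_simps lattice_int)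

lemma lattice_T: "x \<in> L \<Longrightarrow> T x \<in> L"
  using L unfolding char_lattice_def by blast

lemma lattice_e: "e \<in> L"
  using L unfolding char_lattice_def by blast

lemma lattice_act: "x \<in> L \<Longrightarrow> act p x \<in> L"
  by (induction p) (simp_all add: lattice_zero lattice_add lattice_scale lattice_T)

lemma lattice_T_funpow: "x \<in> L \<Longrightarrow> (T ^^ j) x \<in> L"
  by (induction j) (simp_all add: lattice_T)

lemma lattice_char: "x \<in> L \<Longrightarrow> (B x x - B x e) / 2 \<in> \<int>"
  using L unfolding char_lattice_def by blast

lemma lattice_even: "x \<in> L \<Longrightarrow> B (T x) x / 2 \<in> \<int>"
  using L unfolding char_lattice_def by blast

lemmas lattice_intros = lattice_zero lattice_add lattice_diff lattice_scale lattice_T lattice_e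
  lattice_act lattice_T_funpow

text \<open>For \<open>j = 2 * i\<close> and \<open>y = (T ^^ i) e\<close>, the product is
  \<open>B y y\<close>, congruent modulo 2 to \<open>B y e\<close>, a product with smaller exponent.
  For odd \<open>j\<close> it is a value of the even form \<open>B (T x) x\<close>.\<close>

lemma walk_product_even:
  assumes "0 < j"
  shows "B e ((T ^^ j) e) / 2 \<in> \<int>"
  using assms
proof (induction j rule: less_induct)
  case (less j)
  show ?case
  proof (cases "even j")
    case True
    then obtain i where i: "j = i + i" by (metis dvdE mult_2)
    define y where "y = (T ^^ i) e"
    have "B e ((T ^^ j) e) = B y y"
      by (simp add: i funpow_add y_def T_funpow_adjoint)
    moreover have "(B y y - B y e) / 2 \<in> \<int>"
      unfolding y_def by (intro lattice_char lattice_intros)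
    moreover have "B y e / 2 \<in> \<int>"
      using less i by (auto simp: y_def T_funpow_adjoint)
    ultimately show ?thesis by (metis (no_types) Ints_add diff_add_cancel add_divide_distrib)
  next
    case False
    then obtain i where i: "j = Suc (i + i)" by (metis oddE Suc_eq_plus1 mult_2)
    have "B e ((T ^^ j) e) = B (T ((T ^^ i) e)) ((T ^^ i) e)"
      by (simp add: i funpow_add T_funpow_adjoint T_adjoint funpow_swap1)
    thus ?thesis using lattice_even[OF lattice_T_funpow[OF lattice_e]] by simp
  qed
qed

end

end

subsection \<open>Lattices and the cokernel of the walk matrix\<close>

text \<open>In terms of the Smith normal form of the walk matrix, \<open>psi\<close> is the coordinate belonging to the last
  invariant factor \<open>d\<close>, while \<open>par\<close> and \<open>rel\<close> record the parities of those coordinates that the first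
  \<open>n - n div 2\<close> invariant factors, being 1, leave undetermined. The assumption \<open>rel_four\<close> reflects
  that only the last invariant factor can be divisible by 4.\<close>

locale walk_lattice = self_adjoint_module scale B T e
  for scale :: "int \<Rightarrow> 'v::ab_group_add \<Rightarrow> 'v" (infixr "*s" 75) and B T e +
  fixes L0 :: "'v set" and n :: nat and psi :: "'v \<Rightarrow> rat" and d :: int
    and par :: "'v \<Rightarrow> nat set" and rel :: "int poly \<Rightarrow> nat set"
  assumes L0: "char_lattice L0"
    and n_ge_2: "2 \<le> n"
    and B_e_e: "B e e = of_nat n"
    and psi_add: "psi (x + y) = psi x + psi y"
    and psi_scale: "psi (a *s x) = of_int a * psi x"
    and d_pos: "0 < d"
    and psi_dual: "(\<And>j. B x ((T ^^ j) e) \<in> \<int>) \<Longrightarrow> of_int d * psi x \<in> \<int>"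
    and psi_two: "(\<And>j. B x ((T ^^ j) e) \<in> \<int>) \<Longrightarrow> psi (2 *s x) \<in> \<int> \<Longrightarrow> 2 *s x \<in> L0"
    and psi_L0: "x \<in> L0 \<Longrightarrow> psi x \<in> \<int>"
    and par_range: "par z \<subseteq> {n - n div 2..<n}"
    and par_inj: "z \<in> L0 \<Longrightarrow> z' \<in> L0 \<Longrightarrow> (\<And>j. B z ((T ^^ j) e) / 2 \<in> \<int>) \<Longrightarrow>
      (\<And>j. B z' ((T ^^ j) e) / 2 \<in> \<int>) \<Longrightarrow> par z = par z' \<Longrightarrow> z - z' \<in> scale 2 ` L0"
    and rel_range: "rel p \<subseteq> {n - n div 2..<n}"
    and rel_inj: "degree p < n \<Longrightarrow> degree q < n \<Longrightarrow> act p e \<in> scale 2 ` L0 \<Longrightarrow>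
      act q e \<in> scale 2 ` L0 \<Longrightarrow> rel p = rel q \<Longrightarrow> 2 dvd p - q"
    and rel_four: "degree p < n \<Longrightarrow> degree q < n \<Longrightarrow> act p e \<in> scale 4 ` L0 \<Longrightarrow>
      act q e \<in> scale 4 ` L0 \<Longrightarrow> \<not> 2 dvd p \<Longrightarrow> \<not> 2 dvd q \<Longrightarrow> 2 dvd p - q"
begin

abbreviation mult :: "int \<Rightarrow> 'v set" where
  "mult k \<equiv> scale k ` L0"

lemmas L0_intros = lattice_intros[OF L0]

lemma L0_B_int: "x \<in> L0 \<Longrightarrow> y \<in> L0 \<Longrightarrow> B x y \<in> \<int>"
  by (rule lattice_int[OF L0])

lemma mult_zero: "0 \<in> mult k"
  by (rule image_eqI[of _ _ 0]) (simp_all add: L0_intros)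

lemma mult_add: "x \<in> mult k \<Longrightarrow> y \<in> mult k \<Longrightarrow> x + y \<in> mult k"
  by (clarsimp simp: image_iff) (metis scale_right_distrib lattice_add[OF L0])

lemma mult_diff: "x \<in> mult k \<Longrightarrow> y \<in> mult k \<Longrightarrow> x - y \<in> mult k"
  by (clarsimp simp: image_iff) (metis scale_right_diff_distrib lattice_diff[OF L0])

lemma mult_scale:
  assumes "x \<in> mult k"
  shows "a *s x \<in> mult k"
proof -
  obtain y where "y \<in> L0" "x = k *s y" using assms by blast
  thus ?thesis
    by (intro image_eqI[of _ _ "a *s y"]) (simp_all add: L0_intros mult.commute)
qed

lemma mult_act:
  assumes "x \<in> mult k"
  shows "act p x \<in> mult k"
proof -
  obtain y where "y \<in> L0" "x = k *s y" using assms by blast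
  thus ?thesis
    by (intro image_eqI[of _ _ "act p y"]) (simp_all add: L0_intros act_scale_right)
qed

lemma mult_scaleI: "x \<in> L0 \<Longrightarrow> k *s x \<in> mult k"
  by blast

text \<open>The module may have torsion, so \<open>w\<close> need not equal \<open>y\<close>; but
  both have the same pairings, and self-duality of \<open>L0\<close> only sees these.\<close>

lemma mult_cancel:
  assumes "k *s w \<in> mult k" "k \<noteq> 0"
  shows "w \<in> L0"
proof -
  obtain y where y: "y \<in> L0" "k *s w = k *s y" using assms(1) by blast
  have "B w v = B y v" for v
    using arg_cong[OF y(2), of "\<lambda>x. B x v"] assms(2) by (simp add: B_simps)
  thus ?thesis using y(1) by (subst lattice_dual[OF L0]) (simp add: L0_B_int)
qed

lemma mult_diff_sym: "x - y \<in> mult k \<Longrightarrow> y - x \<in> mult k"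
  using mult_diff[OF mult_zero, of "x - y" k] by simp

lemma mult_diff_trans: "x - y \<in> mult k \<Longrightarrow> y - z \<in> mult k \<Longrightarrow> x - z \<in> mult k"
  using mult_add[of "x - y" k "y - z"] by simp

lemma act_two_dvd:
  assumes "2 dvd p" "x \<in> L0"
  shows "act p x \<in> mult 2"
proof -
  obtain q where "p = 2 * q" using assms(1) by (rule dvdE)
  thus ?thesis using assms(2) by (simp add: mult_scaleI L0_intros)
qed

lemma B_act_divisible:
  assumes "\<And>j. B y ((T ^^ j) x) / k \<in> \<int>"
  shows "B y (act p x) / k \<in> \<int>"
  using assms
proof (induction p arbitrary: x)
  case 0
  thus ?case by simp
next
  case (pCons a p)
  have "B y ((T ^^ j) (T x)) / k \<in> \<int>" for j
    using pCons.prems[of "Suc j"] by (simp add: funpow_swap1)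
  hence "B y (act p (T x)) / k \<in> \<int>" by (rule pCons.IH)
  moreover have "of_int a * (B y x / k) \<in> \<int>"
    using pCons.prems[of 0] by (intro Ints_mult Ints_of_int) simp
  ultimately have "of_int a * (B y x / k) + B y (act p (T x)) / k \<in> \<int>" by simp
  thus ?case by (simp add: B_simps act_T add_divide_distrib)
qed

section \<open>Vectors orthogonal to the walk vectors modulo 2\<close>

definition perp :: "'v \<Rightarrow> bool" where
  "perp z \<longleftrightarrow> z \<in> L0 \<and> (\<forall>j. B z ((T ^^ j) e) / 2 \<in> \<int>)"

text \<open>For odd \<open>n\<close> the walk vectors \<open>(T ^^ j) e\<close> are not isotropic modulo 2, because \<open>B e e = n\<close>;
  starting from \<open>T e\<close> instead repairs this.\<close>

definition e' :: 'v where
  "e' = (T ^^ (n mod 2)) e"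

lemma e'_L0: "e' \<in> L0"
  unfolding e'_def by (intro L0_intros)

lemma act_e': "act p e' = act (p * monom 1 (n mod 2)) e"
  by (simp add: e'_def act_mult act_monom)

lemma B_e_e'_even: "B e ((T ^^ j) e') / 2 \<in> \<int>"
proof (cases "j + n mod 2 = 0")
  case True
  hence "even n" "j = 0" by auto
  thus ?thesis by (auto simp: e'_def B_e_e)
next
  case False
  have "(T ^^ j) e' = (T ^^ (j + n mod 2)) e" by (simp add: e'_def funpow_add)
  thus ?thesis using walk_product_even[OF L0, of "j + n mod 2"] False by simp
qed

text \<open>Self-adjointness moves all polynomials in \<open>T\<close> to one side, where
  \<open>B_e_e'_even\<close> applies. So the cyclic module generated by \<open>e'\<close> is
  isotropic modulo 2.\<close>

lemma perp_act: "perp (act p e')"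
proof -
  have "B (act p e') ((T ^^ j) e) / 2 \<in> \<int>" for j
  proof -
    have "B e (act (p * monom 1 j) e') / 2 \<in> \<int>"
      by (intro B_act_divisible B_e_e'_even)
    moreover have "act (p * monom 1 j) e' = (T ^^ j) (act p e')"
      unfolding mult.commute[of p] act_mult act_monom ..
    ultimately show ?thesis by (simp add: B_sym[of "act p e'"] T_funpow_adjoint)
  qed
  thus ?thesis by (simp add: perp_def e'_L0 L0_intros)
qed

lemma perp_B_even:
  assumes "perp z"
  shows "B z (act p e) / 2 \<in> \<int>"
  using assms by (intro B_act_divisible) (simp add: perp_def)

lemma perp_B_even': "perp z \<Longrightarrow> B z (act p e') / 2 \<in> \<int>"
  by (simp add: act_e' perp_B_even)

lemma isotropic: "B (act p e') e' / 2 \<in> \<int>"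
  using perp_B_even'[OF perp_act, of p 1] by simp

text \<open>By \<open>rel_inj\<close> there are at most \<open>2 ^ (n div 2)\<close> relations
  modulo 2 of degree below \<open>n\<close>. A relation \<open>p\<close> that is nonzero modulo 2
  would have \<open>2 ^ k\<close> distinct multiples among them, with
  \<open>k = n - degree p > n div 2\<close>.\<close>

lemma walk_independent:
  assumes "degree p < n - n div 2" "act p e \<in> mult 2"
  shows "2 dvd p"
proof (rule ccontr)
  assume p: "\<not> 2 dvd p"
  define k where "k = n - degree p"
  have k: "n div 2 < k" "0 < k" using assms(1) by (auto simp: k_def)
  define f where "f S = rel (p * zero_one_poly S)" for S
  have deg: "degree (p * zero_one_poly S) < n" if "S \<subseteq> {..<k}" for S
    using degree_mult_le[of p "zero_one_poly S"] degree_zero_one_poly[OF that k(2)] k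
    by (simp add: k_def)
  have mem: "act (p * zero_one_poly S) e \<in> mult 2" for S
    using mult_act[OF assms(2), of "zero_one_poly S"] by (simp add: mult.commute[of p] act_mult)
  have "f ` Pow {..<k} \<subseteq> Pow {n - n div 2..<n}"
    using rel_range by (auto simp: f_def)
  hence "card (f ` Pow {..<k}) \<le> 2 ^ (n div 2)"
    using card_mono[of "Pow {n - n div 2..<n}"] by (simp add: card_Pow)
  also have "\<dots> < 2 ^ k" using k by simp
  also have "2 ^ k = card (Pow {..<k})" by (simp add: card_Pow)
  finally have "\<not> inj_on f (Pow {..<k})" by (metis card_image less_irrefl)
  then obtain S S' where S: "S \<subseteq> {..<k}" "S' \<subseteq> {..<k}" "f S = f S'" "S \<noteq> S'"
    by (auto simp: inj_on_def)
  have "2 dvd p * zero_one_poly S - p * zero_one_poly S'"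
    using S by (intro rel_inj deg mem) (simp_all add: f_def)
  hence "2 dvd p * (zero_one_poly S - zero_one_poly S')" by (simp add: right_diff_distrib)
  hence "2 dvd zero_one_poly S - zero_one_poly S'"
    using p prime_elem_two_poly by (metis prime_elem_dvd_mult_iff)
  moreover have "finite S" "finite S'" using S by (auto intro: finite_subset)
  ultimately show False using S(4) zero_one_poly_cong_imp_eq by blast
qed

lemma two_dvd_mult_monic: "2 dvd p * q \<Longrightarrow> lead_coeff q = 1 \<Longrightarrow> 2 dvd p" for p q :: "int poly"
  using prime_elem_two_poly two_not_dvd_monic by (metis prime_elem_dvd_mult_iff)

lemma walk_independent':
  assumes "degree u < n div 2" "act u e' \<in> mult 2"
  shows "2 dvd u"
proof -
  have "degree (u * monom 1 (n mod 2)) \<le> degree u + n mod 2"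
    by (rule order_trans[OF degree_mult_le]) (simp add: degree_monom_le)
  also have "\<dots> < n div 2 + n mod 2" using assms(1) by simp
  also have "\<dots> = n - n div 2" by presburger
  finally have "2 dvd u * monom 1 (n mod 2)"
    using assms(2) by (intro walk_independent) (simp_all add: act_e')
  thus ?thesis by (rule two_dvd_mult_monic) (simp add: degree_monom_eq)
qed

text \<open>By \<open>par_inj\<close> there are at most \<open>2 ^ (n div 2)\<close> classes modulo
  2 of such \<open>z\<close>. The vectors \<open>act u e'\<close> with 0-1 polynomials
  \<open>u\<close> of degree below \<open>n div 2\<close> are pairwise incongruent by
  \<open>walk_independent'\<close>, so they exhaust the classes.\<close>

lemma perp_representation:
  assumes "perp z"
  obtains u where "degree u < n div 2" "z - act u e' \<in> mult 2"
proof -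
  have m: "0 < n div 2" using n_ge_2 by linarith
  define f where "f S = par (act (zero_one_poly S) e')" for S
  have par_eq: "x - y \<in> mult 2" if "par x = par y" "perp x" "perp y" for x y
    using that by (intro par_inj) (simp_all add: perp_def)
  have inj: "inj_on f (Pow {..<n div 2})"
  proof (rule inj_onI)
    fix S S' assume S: "S \<in> Pow {..<n div 2}" "S' \<in> Pow {..<n div 2}" "f S = f S'"
    have "act (zero_one_poly S - zero_one_poly S') e' \<in> mult 2"
      unfolding act_diff using S by (intro par_eq perp_act) (simp add: f_def)
    moreover have "degree (zero_one_poly S - zero_one_poly S') < n div 2"
      using S m by (intro degree_diff_less degree_zero_one_poly) auto
    ultimately have "2 dvd zero_one_poly S - zero_one_poly S'" by (intro walk_independent')
    moreover have "finite S" "finite S'" using S by (auto intro: finite_subset)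
    ultimately show "S = S'" by (intro zero_one_poly_cong_imp_eq)
  qed
  have "card (f ` Pow {..<n div 2}) = card (Pow {n - n div 2..<n})"
    by (simp add: card_image[OF inj] card_Pow)
  moreover have "f ` Pow {..<n div 2} \<subseteq> Pow {n - n div 2..<n}"
    using par_range by (auto simp: f_def)
  ultimately have eq: "f ` Pow {..<n div 2} = Pow {n - n div 2..<n}"
    by (intro card_subset_eq) simp_all
  have "par z \<in> f ` Pow {..<n div 2}" unfolding eq using par_range by blast
  then obtain S where S: "S \<subseteq> {..<n div 2}" "par z = f S" by auto
  show ?thesis
  proof (rule that)
    show "degree (zero_one_poly S) < n div 2" by (rule degree_zero_one_poly[OF S(1) m])
    show "z - act (zero_one_poly S) e' \<in> mult 2"
      using S(2) by (intro par_eq assms perp_act) (simp add: f_def)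
  qed
qed

text \<open>The vector \<open>(T ^^ (n div 2)) e'\<close> satisfies \<open>perp\<close>, hence is
  modulo 2 a combination of lower iterates. With \<open>walk_independent'\<close> this makes
  \<open>F\<close> the minimal polynomial of \<open>e'\<close> modulo 2.\<close>

lemma ex_annihilator_mod_two:
  "\<exists>F \<gamma>. lead_coeff F = 1 \<and> degree F = n div 2 \<and> \<gamma> \<in> L0 \<and> act F e' = 2 *s \<gamma>"
proof -
  obtain u where u: "degree u < n div 2" "act (monom 1 (n div 2)) e' - act u e' \<in> mult 2"
    by (rule perp_representation[OF perp_act])
  define F where "F = monom 1 (n div 2) - u"
  obtain \<gamma> where "\<gamma> \<in> L0" "act F e' = 2 *s \<gamma>"
    using u(2) by (auto simp: F_def act_diff)
  moreover have "degree F = n div 2"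
    using u(1) degree_add_eq_left[of "- u" "monom 1 (n div 2)"] by (simp add: F_def degree_monom_eq)
  moreover have "coeff F (n div 2) = 1" using u(1) by (simp add: F_def coeff_eq_0)
  ultimately show ?thesis by metis
qed

definition F :: "int poly" where
  "F = (SOME F. \<exists>\<gamma>. lead_coeff F = 1 \<and> degree F = n div 2 \<and> \<gamma> \<in> L0 \<and> act F e' = 2 *s \<gamma>)"

definition \<gamma> :: 'v where
  "\<gamma> = (SOME \<gamma>. \<gamma> \<in> L0 \<and> act F e' = 2 *s \<gamma>)"

lemma F: "lead_coeff F = 1" "degree F = n div 2"
  and ex_\<gamma>: "\<exists>\<gamma>. \<gamma> \<in> L0 \<and> act F e' = 2 *s \<gamma>"
  using someI_ex[OF ex_annihilator_mod_two] unfolding F_def[symmetric] by blast+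

lemma \<gamma>: "\<gamma> \<in> L0" "act F e' = 2 *s \<gamma>"
  using someI_ex[OF ex_\<gamma>] unfolding \<gamma>_def[symmetric] by blast+

text \<open>This is an ideal. It contains 2 because \<open>e'\<close> generates an isotropic module
  modulo 2, so it amounts to an ideal of polynomials over the field with two elements.\<close>

definition null :: "int poly \<Rightarrow> bool" where
  "null p \<longleftrightarrow> (\<forall>q. B (act (p * q) e') e' / 4 \<in> \<int>)"

lemma nullD: "null p \<Longrightarrow> B (act (p * q) e') e' / 4 \<in> \<int>"
  by (simp add: null_def)

lemma null_add: "null p \<Longrightarrow> null q \<Longrightarrow> null (p + q)"
  by (simp add: null_def distrib_right act_add B_simps add_divide_distrib)

lemma null_mult: "null p \<Longrightarrow> null (p * q)"
  by (simp add: null_def mult.assoc)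

lemma null_two: "null (2 * p)"
  using isotropic by (simp add: null_def B_simps mult.assoc)

lemma null_cong:
  assumes "2 dvd p - q" "null q"
  shows "null p"
proof -
  obtain r where "p - q = 2 * r" using assms(1) by (rule dvdE)
  hence "p = q + 2 * r" by (simp add: algebra_simps)
  thus ?thesis using null_add[OF assms(2) null_two] by simp
qed

text \<open>Each factor \<open>F\<close> contributes a factor 2 through
  \<open>act F e' = 2 *s \<gamma>\<close>, one of them after being moved to the other argument of
  \<open>B\<close>.\<close>

lemma null_F_square: "null (F * F)"
proof -
  have "B (act (F * F * q) e') e' / 4 \<in> \<int>" for q
  proof -
    have "F * F * q = F * q * F" by (simp add: mult_ac)
    hence "act (F * F * q) e' = 2 *s act F (act q \<gamma>)"
      by (simp only: act_mult[of "F * q" F] act_mult[of F q] \<gamma> act_scale_right)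
    hence "B (act (F * F * q) e') e' = 2 * B (act F (act q \<gamma>)) e'" by (simp add: B_simps)
    also have "\<dots> = 4 * B (act q \<gamma>) \<gamma>"
      by (simp add: act_adjoint[of F] \<gamma> B_simps)
    finally show ?thesis by (simp add: L0_B_int \<gamma> L0_intros)
  qed
  thus ?thesis by (simp add: null_def)
qed

text \<open>If \<open>B y e\<close> is even, \<open>y\<close> itself satisfies \<open>perp\<close>.
  It can be odd only for odd \<open>n\<close>; then \<open>B e e = n\<close> is odd too and
  \<open>y - e\<close> satisfies \<open>perp\<close>. The constant term \<open>k\<close> of the
  polynomial records which case holds.\<close>

lemma walk_representation:
  assumes y: "y \<in> L0" and orth: "\<And>j. B y ((T ^^ j) e') / 2 \<in> \<int>"
  obtains r where "degree r < n" "y - act r e \<in> mult 2"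
proof -
  note result = that
  have *: thesis if k: "k = 0 \<or> k = 1" and y': "perp (y - k *s e)" for k
  proof -
    from y' obtain u where u: "degree u < n div 2" "y - k *s e - act u e' \<in> mult 2"
      by (rule perp_representation)
    show thesis
    proof (rule result)
      have "degree (u * monom 1 (n mod 2)) \<le> degree u + n mod 2"
        by (rule order_trans[OF degree_mult_le]) (simp add: degree_monom_le)
      also have "\<dots> < n" using u(1) by presburger
      finally show "degree ([:k:] + u * monom 1 (n mod 2)) < n"
        using n_ge_2 by (intro degree_add_less) auto
      show "y - act ([:k:] + u * monom 1 (n mod 2)) e \<in> mult 2"
        using u(2) by (simp add: act_add act_e' algebra_simps)
    qed
  qed
  have Suc_j: "B y ((T ^^ j) e) / 2 \<in> \<int>" if "n mod 2 \<le> j" for j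
  proof -
    have "(T ^^ j) e = (T ^^ (j - n mod 2)) e'" 
      using that funpow_add[of "j - n mod 2" "n mod 2" T] by (simp add: e'_def)
    thus ?thesis using orth by simp
  qed
  show thesis
  proof (cases "B y e / 2 \<in> \<int>")
    case True
    have "B y ((T ^^ j) e) / 2 \<in> \<int>" for j
      using True Suc_j[of j] by (cases j) (auto simp del: funpow.simps)
    hence "perp (y - 0 *s e)" using y by (simp add: perp_def)
    thus thesis using *[of 0] by blast
  next
    case False
    have odd: "odd n"
    proof
      assume "even n"
      thus False using Suc_j[of 0] False by simp
    qed
    obtain k where k: "B y e = of_int k" using L0_B_int[OF y, of e] by (auto simp: L0_intros elim: Ints_cases)
    have "odd k" using False by (auto simp: k elim!: evenE)
    have "B (y - e) ((T ^^ j) e) / 2 \<in> \<int>" for j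
    proof (cases "j = 0")
      case True
      have "B (y - e) e = of_int (k - int n)" by (simp add: B_simps k B_e_e)
      moreover have "even (k - int n)" using \<open>odd k\<close> odd by simp
      ultimately have "B (y - e) e / 2 \<in> \<int>" by (simp only: half_Ints_iff_even)
      thus ?thesis using True by simp
    next
      case False
      thus ?thesis using Suc_j[of j] walk_product_even[OF L0, of j]
        by (simp add: B_simps diff_divide_distrib)
    qed
    hence "perp (y - 1 *s e)" using y by (simp add: perp_def L0_intros)
    thus thesis using *[of 1] by blast
  qed
qed

text \<open>Write \<open>act (F * p) e' = 2 *s y\<close>. The assumption makes \<open>y\<close>
  orthogonal modulo 2 to the iterates of \<open>e'\<close>, so \<open>y\<close> is congruent to some
  \<open>act r e\<close>, and subtracting \<open>2 * r\<close> turns a relation modulo 2 into one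
  modulo 4.\<close>

lemma null_F_lift:
  assumes "null (F * p)" "degree p < n div 2"
  obtains r where "degree (F * p * monom 1 (n mod 2) - 2 * r) < n"
    "act (F * p * monom 1 (n mod 2) - 2 * r) e \<in> mult 4"
proof -
  define y where "y = act p \<gamma>"
  have y: "y \<in> L0" by (simp add: y_def \<gamma> L0_intros)
  have act: "act (F * p) e' = 2 *s y"
    by (simp add: y_def mult.commute[of F] act_mult \<gamma> act_scale_right)
  have "B y ((T ^^ j) e') / 2 \<in> \<int>" for j
  proof -
    have "B (act (F * p * monom 1 j) e') e' = B ((T ^^ j) (act (F * p) e')) e'"
      by (simp add: mult.commute[of "F * p"] act_mult[of "monom 1 j"] act_monom)
    also have "\<dots> = 2 * B y ((T ^^ j) e')"
      by (simp add: act T_funpow_adjoint B_simps)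
    finally have "2 * B y ((T ^^ j) e') / 4 \<in> \<int>"
      using nullD[OF assms(1), of "monom 1 j"] by simp
    thus ?thesis by simp
  qed
  then obtain r where r: "degree r < n" "y - act r e \<in> mult 2"
    using walk_representation[OF y] by blast
  show ?thesis
  proof (rule that)
    have "degree (F * p * monom 1 (n mod 2)) \<le> degree F + degree p + n mod 2"
      by (intro order_trans[OF degree_mult_le] add_mono degree_mult_le degree_monom_le)
    also have "\<dots> < n" using assms(2) F(2) by presburger
    finally have "degree (F * p * monom 1 (n mod 2)) < n" .
    moreover have "degree (2 * r) < n"
      using r(1) degree_smult_le[of 2 r] by (simp add: numeral_mult_conv_smult)
    ultimately show "degree (F * p * monom 1 (n mod 2) - 2 * r) < n"
      by (intro degree_diff_less)
    have "act (F * p * monom 1 (n mod 2) - 2 * r) e = 2 *s (y - act r e)"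
      by (simp add: act_diff act_e'[symmetric] act scale_right_diff_distrib)
    also have "\<dots> \<in> mult 4" using r(2) by auto
    finally show "act (F * p * monom 1 (n mod 2) - 2 * r) e \<in> mult 4" .
  qed
qed

text \<open>The lifts are relations modulo 4 that do not vanish modulo 2, so \<open>rel_four\<close>
  identifies them modulo 2. The factors \<open>F\<close> and \<open>monom 1 (n mod 2)\<close> are
  monic and cancel.\<close>

lemma null_F_unique:
  assumes "null (F * p)" "degree p < n div 2" "\<not> 2 dvd p"
    and "null (F * q)" "degree q < n div 2" "\<not> 2 dvd q"
  shows "2 dvd p - q"
proof -
  obtain r where r: "degree (F * p * monom 1 (n mod 2) - 2 * r) < n"
    "act (F * p * monom 1 (n mod 2) - 2 * r) e \<in> mult 4"
    using assms(1,2) by (rule null_F_lift)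
  obtain s where s: "degree (F * q * monom 1 (n mod 2) - 2 * s) < n"
    "act (F * q * monom 1 (n mod 2) - 2 * s) e \<in> mult 4"
    using assms(4,5) by (rule null_F_lift)
  have *: "2 dvd t" if "2 dvd F * t * monom 1 (n mod 2)" for t
    using that F(1) by (metis two_dvd_mult_monic mult.commute degree_monom_eq lead_coeff_monom one_neq_zero)
  have **: "2 dvd t" if "2 dvd F * t * monom 1 (n mod 2) - 2 * u" for t u
    using that * by (metis diff_add_cancel dvd_add dvd_triv_left)
  have "2 dvd (F * p * monom 1 (n mod 2) - 2 * r) - (F * q * monom 1 (n mod 2) - 2 * s)"
    using assms(3,6) by (intro rel_four r s) (blast dest: **)+
  hence "2 dvd F * (p - q) * monom 1 (n mod 2) - 2 * (r - s)" by (simp add: algebra_simps)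
  thus ?thesis by (rule **)
qed

lemma null_square_cong:
  assumes "2 dvd c - c'" "null (c' * c')"
  shows "null (c * c)"
proof (rule null_cong[OF _ assms(2)])
  have "c * c - c' * c' = (c - c') * (c + c')" by (simp add: algebra_simps)
  thus "2 dvd c * c - c' * c'" using assms(1) by simp
qed

text \<open>The \<open>c\<close> with \<open>null (c * c)\<close> form an ideal, which is principal modulo 2, generated by some \<open>g\<close>
  dividing \<open>F\<close>. If \<open>F = g * k\<close> and \<open>c = g * s\<close> then \<open>g * g\<close> divides \<open>F * c\<close>.\<close>

lemma null_square_imp_null_F:
  assumes "null (c * c)"
  shows "null (F * c)"
proof -
  \<comment> \<open>The generator is a monic polynomial of least degree; \<open>F\<close> shows that
    one exists. Then \<open>gen\<close> is division by \<open>g\<close> modulo 2.\<close>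
  define deg where "deg = (LEAST k. \<exists>g. lead_coeff g = 1 \<and> null (g * g) \<and> degree g = k)"
  have "\<exists>g. lead_coeff g = 1 \<and> null (g * g) \<and> degree g = deg"
    unfolding deg_def by (rule LeastI[of _ "degree F"]) (use F null_F_square in blast)
  then obtain g where g: "lead_coeff g = 1" "null (g * g)" "degree g = deg" by blast
  have least: "deg \<le> degree h" if "lead_coeff h = 1" "null (h * h)" for h
    unfolding deg_def by (rule Least_le) (use that in blast)
  have gen: "\<exists>s. 2 dvd c - g * s" if "null (c * c)" for c
    using that
  proof (induction "degree c" arbitrary: c rule: less_induct)
    case less
    show ?case
    proof (cases "2 dvd c \<or> degree g = 0")
      case True
      thus ?thesis
      proof
        assume "2 dvd c"
        thus ?thesis by (intro exI[of _ 0]) simp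
      next
        assume "degree g = 0"
        hence "g = 1" using g(1) by (auto elim!: degree_eq_zeroE simp: one_pCons)
        thus ?thesis by (intro exI[of _ c]) simp
      qed
    next
      case False
      then obtain h where h: "lead_coeff h = 1" "degree h \<le> degree c" "2 dvd c - h"
        using monic_cong_mod_two[of c] by blast
      have "2 dvd h - c" using h(3) by (metis dvd_minus_iff minus_diff_eq)
      hence "null (h * h)" using less.prems null_square_cong by blast
      hence deg: "degree g \<le> degree h" using least h(1) g(3) by simp
      have "g \<noteq> 0" using g(1) by auto
      define w where "w = monom 1 (degree h - degree g) * g"
      have "lead_coeff w = 1" using g(1) by (simp add: w_def lead_coeff_mult degree_monom_eq)
      moreover have "degree w = degree h"
        using deg \<open>g \<noteq> 0\<close> by (simp add: w_def degree_mult_eq degree_monom_eq)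
      ultimately have w: "degree w = degree h" "coeff w (degree h) = 1" by simp_all
      have "coeff (h - w) (degree h) = 0" using h(1) w by simp
      moreover have "degree (h - w) \<le> degree h" using w by (intro degree_diff_le) simp_all
      moreover have "degree h \<noteq> 0" using deg False by simp
      ultimately have "degree (h - w) < degree h"
        by (metis le_neq_implies_less leading_coeff_0_iff degree_0)
      moreover have "null ((h - w) * (h - w))"
      proof -
        \<comment> \<open>Squaring is additive modulo 2, so the remainder \<open>h - w\<close> again
          has a null square.\<close>
        have "null (h * h + g * g * (monom 1 (degree h - degree g)) ^ 2 + 2 * (- h * w))"
          by (intro null_add null_two null_mult \<open>null (h * h)\<close> g(2))
        moreover have "(h - w) * (h - w) = h * h + g * g * (monom 1 (degree h - degree g)) ^ 2 + 2 * (- h * w)"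
          by (simp add: w_def algebra_simps power2_eq_square)
        ultimately show ?thesis by simp
      qed
      ultimately obtain s where s: "2 dvd h - w - g * s"
        using less.hyps[of "h - w"] h(2) by auto
      have "c - g * (s + monom 1 (degree h - degree g)) = (c - h) + (h - w - g * s)"
        by (simp add: w_def algebra_simps)
      thus ?thesis using h(3) s by (metis dvd_add)
    qed
  qed
  obtain k where k: "2 dvd F - g * k" using gen[OF null_F_square] by blast
  obtain s where s: "2 dvd c - g * s" using gen[OF assms] by blast
  have "F * c - g * g * (k * s) = F * (c - g * s) + (F - g * k) * (g * s)" by (simp add: algebra_simps)
  hence "2 dvd F * c - g * g * (k * s)" using k s by (metis dvd_add dvd_mult dvd_mult2)
  thus ?thesis by (rule null_cong) (intro null_mult g)
qed

subsection \<open>Vectors of order 2\<close>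

text \<open>Modulo 4 the value \<open>B z (act p z)\<close> depends only on \<open>z\<close> modulo
  2: for \<open>z = w + 2 *s y\<close> the two cross terms agree by self-adjointness, so together
  they are divisible by 4.\<close>

lemma quadratic_cong:
  assumes "z - act c e' \<in> mult 2"
  shows "(B z (act p z) - B (act (c * c * p) e') e') / 4 \<in> \<int>"
proof -
  define w where "w = act c e'"
  have w: "w \<in> L0" by (simp add: w_def e'_L0 L0_intros)
  obtain y where y: "y \<in> L0" "z - w = 2 *s y" using assms by (auto simp: w_def)
  hence z: "z = w + 2 *s y" by (simp add: algebra_simps)
  have "c * c * p = c * (p * c)" by (simp add: mult_ac)
  hence "act (c * c * p) e' = act c (act p w)" by (simp only: w_def act_mult[of c "p * c"] act_mult[of p c])
  hence "B (act (c * c * p) e') e' = B w (act p w)"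
    by (simp only: act_adjoint[of c "act p w"] B_sym[of "act p w"] flip: w_def)
  moreover have "B y (act p w) = B w (act p y)"
    by (metis B_sym act_adjoint)
  ultimately have eq: "(B z (act p z) - B (act (c * c * p) e') e') / 4 = B w (act p y) + B y (act p y)"
    by (simp add: z act_add_right act_scale_right B_simps algebra_simps)
  show ?thesis unfolding eq using w y by (simp add: L0_B_int L0_intros)
qed

text \<open>By \<open>quad_two\<close>, doubling an element of order 2 of the quotient of any
  characteristic lattice yields such a vector.\<close>

definition quad :: "'v \<Rightarrow> bool" where
  "quad z \<longleftrightarrow> perp z \<and> (\<forall>j. B z ((T ^^ j) z) / 4 \<in> \<int>)"

lemma quad_representation:
  assumes "quad z"
  obtains c where "degree c < n div 2" "z - act c e' \<in> mult 2" "null (c * c)"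
proof -
  obtain c where c: "degree c < n div 2" "z - act c e' \<in> mult 2"
    using assms perp_representation by (auto simp: quad_def)
  have "B (act (c * c * p) e') e' / 4 \<in> \<int>" for p
  proof -
    have "B z (act p z) / 4 \<in> \<int>"
      using assms by (intro B_act_divisible) (simp add: quad_def)
    from Ints_diff[OF this quadratic_cong[OF c(2), of p]] show ?thesis
      by (simp add: diff_divide_distrib)
  qed
  hence "null (c * c)" by (simp add: null_def)
  with c show ?thesis by (rule that)
qed

lemma not_two_dvd_representation:
  assumes "z - act c e' \<in> mult 2" "z \<notin> mult 2"
  shows "\<not> 2 dvd c"
proof
  assume "2 dvd c"
  hence "act c e' \<in> mult 2" by (intro act_two_dvd e'_L0)
  from mult_add[OF assms(1) this] show False using assms(2) by simp
qed

text \<open>Both vectors are represented by polynomials with null squares, nonzero modulo 2.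
  Multiplied by \<open>F\<close> these become null, so \<open>null_F_unique\<close> identifies them
  modulo 2.\<close>

lemma quad_unique:
  assumes "quad z" "z \<notin> mult 2" "quad z'" "z' \<notin> mult 2"
  shows "z - z' \<in> mult 2"
proof -
  obtain c where c: "degree c < n div 2" "z - act c e' \<in> mult 2" "null (c * c)"
    using assms(1) by (rule quad_representation)
  obtain c' where c': "degree c' < n div 2" "z' - act c' e' \<in> mult 2" "null (c' * c')"
    using assms(3) by (rule quad_representation)
  have "2 dvd c - c'"
    using assms c c'
    by (intro null_F_unique null_square_imp_null_F not_two_dvd_representation[of z] not_two_dvd_representation[of z'])
  hence "act c e' - act c' e' \<in> mult 2"
    unfolding act_diff[symmetric] by (intro act_two_dvd e'_L0)
  hence "z - act c' e' \<in> mult 2" using c(2) mult_diff_trans by blast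
  thus ?thesis using c'(2) mult_diff_sym mult_diff_trans by blast
qed

text \<open>If \<open>h = act c e'\<close> and \<open>z = act u e'\<close> modulo 2, then evaluating the condition on \<open>z\<close> at \<open>c * c\<close> shows
  that \<open>c\<close> has the root \<open>b\<close> modulo 2. As \<open>F = [:-b, 1:] * c\<close> modulo 2, both \<open>c\<close> and the quotient
  of \<open>c\<close> by \<open>[:-b, 1:]\<close> then contradict the uniqueness in \<open>null_F_unique\<close>.\<close>

lemma no_eigenvector:
  assumes h: "quad h" "h \<notin> mult 2" "T h - b *s h \<in> mult 2"
    and z: "perp z" "\<And>j. (B z ((T ^^ j) z) - 2 * of_int (b ^ j)) / 4 \<in> \<int>"
  shows False
proof -
  obtain c where c: "degree c < n div 2" "h - act c e' \<in> mult 2" "null (c * c)"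
    using h(1) by (rule quad_representation)
  have c2: "\<not> 2 dvd c" using c(2) h(2) by (rule not_two_dvd_representation)
  obtain u where u: "z - act u e' \<in> mult 2" using z(1) by (rule perp_representation)
  \<comment> \<open>Linearity extends the hypothesis on powers of \<open>T\<close> to polynomials:
    modulo 4, pairing \<open>z\<close> with \<open>p\<close> applied to \<open>z\<close> gives twice
    the value of \<open>p\<close> at \<open>b\<close>.\<close>
  have "(B z (act p ((T ^^ j) z)) - 2 * of_int (b ^ j * poly p b)) / 4 \<in> \<int>" for p j
  proof (induction p arbitrary: j)
    case 0
    thus ?case by simp
  next
    case (pCons a p)
    have "of_int a * ((B z ((T ^^ j) z) - 2 * of_int (b ^ j)) / 4) +
        (B z (act p ((T ^^ Suc j) z)) - 2 * of_int (b ^ Suc j * poly p b)) / 4 \<in> \<int>"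
      using z(2)[of j] pCons.IH[of "Suc j"] by (intro Ints_add Ints_mult Ints_of_int)
    thus ?case by (simp add: B_simps act_T add_divide_distrib diff_divide_distrib algebra_simps)
  qed
  from this[of "c * c" 0] have "(B z (act (c * c) z) - 2 * of_int (poly c b * poly c b)) / 4 \<in> \<int>"
    by simp
  moreover have "B (act (u * u * (c * c)) e') e' / 4 \<in> \<int>"
    using nullD[OF c(3), of "u * u"] by (simp add: mult_ac)
  moreover note quadratic_cong[OF u, of "c * c"]
  ultimately have "(B z (act (c * c) z) - B (act (u * u * (c * c)) e') e') / 4
      + B (act (u * u * (c * c)) e') e' / 4
      - (B z (act (c * c) z) - 2 * of_int (poly c b * poly c b)) / 4 \<in> \<int>"
    by (intro Ints_add Ints_diff)
  hence "(of_int (poly c b * poly c b) :: rat) / 2 \<in> \<int>" by (simp add: field_simps)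
  hence even: "even (poly c b)" unfolding half_Ints_iff_even by simp
  define X where "X = [:-b, 1:]"
  define c' where "c' = synthetic_div c b"
  have X: "lead_coeff X = 1" by (simp add: X_def)
  have "c - X * c' = [:poly c b:]"
    using synthetic_div_correct'[of b c] by (simp add: X_def c'_def algebra_simps)
  hence cc': "2 dvd c - X * c'" using even by (simp add: numeral_poly)
  \<comment> \<open>This is the coefficient of \<open>X * c\<close> at \<open>n div 2\<close>, so
    subtracting \<open>\<kappa>\<close> times \<open>F\<close> brings the degree below
    \<open>n div 2\<close>. The difference kills \<open>e'\<close> modulo 2 because \<open>X\<close>
    kills \<open>h\<close>.\<close>
  define \<kappa> where "\<kappa> = coeff c (n div 2 - 1)"
  have "2 dvd X * c - Polynomial.smult \<kappa> F"
  proof (rule walk_independent')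
    have "degree (X * c - Polynomial.smult \<kappa> F) \<le> n div 2"
    proof (rule degree_diff_le)
      show "degree (X * c) \<le> n div 2"
        using degree_mult_le[of X c] c(1) by (simp add: X_def)
      show "degree (Polynomial.smult \<kappa> F) \<le> n div 2"
        using degree_smult_le[of \<kappa> F] F(2) by simp
    qed
    moreover have "coeff (X * c - Polynomial.smult \<kappa> F) (n div 2) = 0"
    proof -
      have "coeff F (n div 2) = 1" using F by simp
      moreover obtain k where "n div 2 = Suc k" using c(1) by (cases "n div 2") auto
      ultimately show ?thesis using c(1) by (simp add: X_def \<kappa>_def coeff_eq_0)
    qed
    moreover have "n div 2 \<noteq> 0" using c(1) by simp
    ultimately show "degree (X * c - Polynomial.smult \<kappa> F) < n div 2"
      by (metis le_neq_implies_less leading_coeff_0_iff degree_0)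
    have "act X (act c e') = act X h - act X (h - act c e')" by (simp add: act_diff_right)
    moreover have "act X h \<in> mult 2" using h(3) by (simp add: X_def algebra_simps)
    ultimately have "act (X * c) e' \<in> mult 2"
      using mult_diff mult_act[OF c(2)] by (simp add: act_mult)
    moreover have "act (Polynomial.smult \<kappa> F) e' \<in> mult 2"
      unfolding act_smult \<gamma> by (intro mult_scale mult_scaleI \<gamma>)
    ultimately show "act (X * c - Polynomial.smult \<kappa> F) e' \<in> mult 2"
      unfolding act_diff by (rule mult_diff)
  qed
  then obtain r where r: "X * c - Polynomial.smult \<kappa> F = 2 * r" by (rule dvdE)
  have "odd \<kappa>"
  proof
    assume "even \<kappa>"
    then obtain l where "\<kappa> = 2 * l" by (rule evenE)
    hence "c * X = 2 * (r + Polynomial.smult l F)"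
      using r by (simp add: numeral_mult_conv_smult smult_add_right algebra_simps)
    hence "2 dvd c * X" by (metis dvd_triv_left)
    thus False using c2 X two_dvd_mult_monic by blast
  qed
  then obtain l where "\<kappa> = 2 * l + 1" by (rule oddE)
  hence "F - X * c = 2 * (- r - Polynomial.smult l F)"
    using r by (simp add: numeral_mult_conv_smult smult_add_left smult_diff_right algebra_simps)
  hence FX: "2 dvd F - X * c" by (metis dvd_triv_left)
  \<comment> \<open>Modulo 2 both \<open>F * c'\<close> and \<open>c * c\<close> are
    \<open>X * c * c'\<close>, which makes \<open>F * c'\<close> null.\<close>
  have "F * c' - c * c = (F - X * c) * c' - (c - X * c') * c" by (simp add: algebra_simps)
  hence "2 dvd F * c' - c * c" using FX cc' by (metis dvd_diff dvd_mult2)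
  hence "null (F * c')" using c(3) by (rule null_cong)
  moreover have "degree c' < n div 2" using c(1) by (simp add: c'_def degree_synthetic_div)
  moreover have "\<not> 2 dvd c'"
  proof
    assume "2 dvd c'"
    hence "2 dvd X * c'" by simp
    from dvd_add[OF cc' this] show False using c2 by simp
  qed
  ultimately have "2 dvd c - c'"
    using null_square_imp_null_F[OF c(3)] c(1) c2 null_F_unique by blast
  \<comment> \<open>Now \<open>c\<close> is congruent both to \<open>c'\<close> and to
    \<open>X * c'\<close>, so the monic polynomial \<open>X - 1\<close> would annihilate
    \<open>c\<close> modulo 2.\<close>
  moreover have "c * (X - 1) = X * (c - c') - (c - X * c')" by (simp add: algebra_simps)
  ultimately have "2 dvd c * (X - 1)" using cc' by (metis dvd_diff dvd_mult)
  moreover have "lead_coeff (X - 1) = 1" by (simp add: X_def one_pCons)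
  ultimately show False using c2 two_dvd_mult_monic by blast
qed

lemma perp_B_perp_even:
  assumes "perp z" "perp z'"
  shows "B z ((T ^^ j) z') / 2 \<in> \<int>"
proof -
  obtain u where "z' - act u e' \<in> mult 2" using assms(2) by (rule perp_representation)
  then obtain y where y: "y \<in> L0" "z' - act u e' = 2 *s y" by blast
  hence "z' = act u e' + 2 *s y" by (simp add: algebra_simps)
  hence "(T ^^ j) z' = act (monom 1 j * u) e' + 2 *s act (monom 1 j) y"
    by (simp add: act_mult act_add_right act_scale_right flip: act_monom)
  hence eq: "B z ((T ^^ j) z') / 2 = B z (act (monom 1 j * u) e') / 2 + B z (act (monom 1 j) y)"
    by (simp add: B_simps add_divide_distrib)
  have "B z (act (monom 1 j) y) \<in> \<int>"
    using assms(1) y(1) by (intro L0_B_int L0_intros) (simp_all add: perp_def)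
  thus ?thesis unfolding eq by (intro Ints_add perp_B_even' assms(1))
qed

subsection \<open>Comparison of two lattices of the same level\<close>

lemma psi_two_lattice:
  assumes "char_lattice L" "x \<in> L" "psi (2 *s x) \<in> \<int>"
  shows "2 *s x \<in> L0"
  using assms(2,3) lattice_intros[OF assms(1)] lattice_int[OF assms(1)] by (intro psi_two) simp_all

lemma psi_diff: "psi (x - y) = psi x - psi y"
  using psi_add[of "x - y" y] by simp

lemma quad_two:
  assumes "char_lattice L" "x \<in> L" "2 *s x \<in> L0"
  shows "quad (2 *s x)"
proof -
  have "(T ^^ j) (2 *s x) = 2 *s (T ^^ j) x" for j
    by (metis act_monom act_scale_right)
  thus ?thesis
    using assms lattice_intros[OF assms(1)] lattice_int[OF assms(1)]
    by (simp add: quad_def perp_def B_simps)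
qed

lemma two_torsion_unique:
  assumes "char_lattice L" "x \<in> L" "2 *s x \<in> L0" "x \<notin> L0"
    and "char_lattice L'" "y \<in> L'" "2 *s y \<in> L0" "y \<notin> L0"
  shows "x - y \<in> L0"
proof -
  have "2 *s x \<notin> mult 2" "2 *s y \<notin> mult 2"
    by (rule contrapos_nn[OF assms(4)], erule mult_cancel, simp)
      (rule contrapos_nn[OF assms(8)], erule mult_cancel, simp)
  hence "2 *s x - 2 *s y \<in> mult 2"
    by (intro quad_unique quad_two[OF assms(1-3)] quad_two[OF assms(5-7)])
  hence "2 *s (x - y) \<in> mult 2" by (simp add: scale_right_diff_distrib)
  thus ?thesis by (rule mult_cancel) simp
qed

text \<open>The level is the exponent of the quotient of \<open>L\<close> by its intersection with
  \<open>L0\<close>.\<close>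

definition has_level :: "'v set \<Rightarrow> int \<Rightarrow> bool" where
  "has_level L l \<longleftrightarrow> 0 < l \<and> (\<forall>k. (\<forall>x\<in>L. k *s x \<in> L0) \<longleftrightarrow> l dvd k)"

lemma has_levelD: "has_level L l \<Longrightarrow> x \<in> L \<Longrightarrow> l *s x \<in> L0"
  by (auto simp: has_level_def)

text \<open>Modulo 1, \<open>psi\<close> embeds twice the quotient of \<open>L\<close> into the
  cyclic group of fractions with denominator \<open>d\<close>. So twice the quotient is cyclic, and
  its order \<open>N\<close> is determined by \<open>l\<close>.\<close>

lemma psi_generator:
  assumes L: "char_lattice L" and l: "has_level L l"
  obtains N g where "0 < N" "\<And>k. N dvd k \<longleftrightarrow> l dvd 2 * k" "g \<in> L"
    "psi (2 *s g) - 1 / of_int N \<in> \<int>" "\<And>x. x \<in> L \<Longrightarrow> \<exists>a. 2 *s (x - a *s g) \<in> L0"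
proof -
  \<comment> \<open>The numerators over \<open>d\<close> of the values of \<open>psi\<close>; the
    summand with \<open>t\<close> accounts for working modulo 1 and puts \<open>d\<close> into
    \<open>K\<close>.\<close>
  define K where "K = {k. \<exists>x\<in>L. \<exists>t. of_int k = of_int d * psi (2 *s x) + of_int (d * t)}"
  have K_add: "k + k' \<in> K" if k: "k \<in> K" "k' \<in> K" for k k'
  proof -
    from k obtain x t x' t' where
      x: "x \<in> L" "of_int k = of_int d * psi (2 *s x) + of_int (d * t)"
      "x' \<in> L" "of_int k' = of_int d * psi (2 *s x') + of_int (d * t')"
      unfolding K_def by blast
    have "of_int (k + k') = of_int d * psi (2 *s (x + x')) + of_int (d * (t + t'))"
      using x(2,4) by (simp add: psi_scale psi_add algebra_simps)
    thus ?thesis unfolding K_def using lattice_add[OF L x(1,3)] by blast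
  qed
  have K_scale: "a * k \<in> K" if k: "k \<in> K" for a k
  proof -
    from k obtain x t where x: "x \<in> L" "of_int k = of_int d * psi (2 *s x) + of_int (d * t)"
      unfolding K_def by blast
    have "of_int (a * k) = of_int d * psi (2 *s (a *s x)) + of_int (d * (a * t))"
      using x(2) by (simp add: psi_scale algebra_simps)
    thus ?thesis unfolding K_def using lattice_scale[OF L x(1)] by blast
  qed
  have "psi 0 = 0" using psi_add[of 0 0] by simp
  hence "of_int d = of_int d * psi (2 *s 0) + of_int (d * 1)" by simp
  hence K_d: "d \<in> K" unfolding K_def using lattice_zero[OF L] by blast
  obtain r where r: "r \<in> K" "0 < r" "\<And>k. k \<in> K \<Longrightarrow> r dvd k"
    using int_subgroup_generator[OF K_add K_scale K_d d_pos] by blast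
  obtain N where N: "d = r * N" using r(3)[OF K_d] by (rule dvdE)
  have "0 < N" using N d_pos r(2) by (simp add: zero_less_mult_iff)
  from r(1) obtain g t where g: "g \<in> L" "of_int r = of_int d * psi (2 *s g) + of_int (d * t)"
    unfolding K_def by blast
  have "of_int r * (of_int N * (psi (2 *s g) + of_int t)) = of_int r * 1"
    using g(2) by (simp add: N algebra_simps)
  hence "of_int N * (psi (2 *s g) + of_int t) = 1" using r(2) by simp
  hence psi_g: "psi (2 *s g) = 1 / of_int N - of_int t"
    using \<open>0 < N\<close> by (simp add: field_simps)
  have ints: "of_int N * psi (2 *s x) \<in> \<int>" if x: "x \<in> L" for x
  proof -
    have "of_int d * psi (2 *s x) \<in> \<int>"
      using x lattice_intros[OF L] lattice_int[OF L] by (intro psi_dual) simp_all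
    then obtain k where k: "of_int d * psi (2 *s x) = of_int k" by (rule Ints_cases)
    hence "k \<in> K" using x unfolding K_def by (auto intro!: bexI[of _ x] exI[of _ 0])
    then obtain s where "k = r * s" using r(3) by (metis dvdE)
    hence "of_int N * psi (2 *s x) = of_int s" using k r(2) by (simp add: N)
    thus ?thesis by simp
  qed
  show ?thesis
  proof (rule that)
    show "\<exists>a. 2 *s (x - a *s g) \<in> L0" if x: "x \<in> L" for x
    proof -
      obtain a where a: "of_int N * psi (2 *s x) = of_int a" using ints[OF x] by (rule Ints_cases)
      hence psi_x: "psi (2 *s x) = of_int a / of_int N" using \<open>0 < N\<close> by (simp add: field_simps)
      have "psi (2 *s (x - a *s g)) = psi (2 *s x) - of_int a * psi (2 *s g)"
        by (simp add: psi_scale psi_diff algebra_simps)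
      also have "\<dots> = of_int (a * t)" unfolding psi_x psi_g by (simp add: algebra_simps)
      finally have "psi (2 *s (x - a *s g)) = of_int (a * t)" .
      thus ?thesis using x g lattice_intros[OF L] by (intro exI[of _ a] psi_two_lattice[OF L]) simp_all
    qed
    show "N dvd k \<longleftrightarrow> l dvd 2 * k" for k
    proof -
      have "l dvd 2 * k \<longleftrightarrow> (\<forall>x\<in>L. (2 * k) *s x \<in> L0)" using l by (simp add: has_level_def)
      also have "\<dots> \<longleftrightarrow> N dvd k"
      proof
        assume *: "\<forall>x\<in>L. (2 * k) *s x \<in> L0"
        have "psi ((2 * k) *s g) \<in> \<int>" using * g(1) psi_L0 by blast
        hence "psi ((2 * k) *s g) + of_int (k * t) \<in> \<int>" by simp
        moreover have "psi ((2 * k) *s g) = of_int k * psi (2 *s g)" by (simp add: psi_scale)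
        hence "psi ((2 * k) *s g) + of_int (k * t) = of_int k / of_int N"
          unfolding psi_g by (simp add: algebra_simps)
        ultimately have "of_int k / of_int N \<in> (\<int> :: rat set)" by (simp only:)
        then obtain q where "of_int k / of_int N = (of_int q :: rat)" by (rule Ints_cases)
        hence "of_int k = (of_int (q * N) :: rat)" using \<open>0 < N\<close> by (simp add: field_simps)
        hence "k = q * N" by (simp only: of_int_eq_iff)
        thus "N dvd k" by simp
      next
        assume "N dvd k"
        then obtain q where q: "k = N * q" by (rule dvdE)
        show "\<forall>x\<in>L. (2 * k) *s x \<in> L0"
        proof
          fix x assume x: "x \<in> L"
          have "psi (2 *s (k *s x)) = of_int q * (of_int N * psi (2 *s x))"
            by (simp add: psi_scale q)
          hence "psi (2 *s (k *s x)) \<in> \<int>" using ints[OF x] by simp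
          hence "2 *s (k *s x) \<in> L0" using x lattice_scale[OF L] by (intro psi_two_lattice[OF L])
          thus "(2 * k) *s x \<in> L0" by simp
        qed
      qed
      finally show ?thesis by blast
    qed
  qed (use \<open>0 < N\<close> g psi_g in simp_all)
qed

lemma odd_level_two_torsion:
  assumes "odd l" "l *s w \<in> L0" "2 *s w \<in> L0"
  shows "w \<in> L0"
proof -
  obtain k where "l = 2 * k + 1" using assms(1) by (rule oddE)
  hence "w = l *s w - k *s (2 *s w)" by (simp add: scale_left_distrib mult.commute)
  moreover have "l *s w - k *s (2 *s w) \<in> L0"
    using assms(2,3) lattice_diff[OF L0] lattice_scale[OF L0] by blast
  ultimately show ?thesis by simp
qed

lemma even_level_two_torsion:
  assumes "has_level L l" "even l" "char_lattice L"
  obtains t where "t \<in> L" "2 *s t \<in> L0" "t \<notin> L0"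
proof -
  obtain k where k: "l = 2 * k" using assms(2) by (rule evenE)
  have "0 < k" using assms(1) k by (simp add: has_level_def)
  hence "\<not> l dvd k" using k zdvd_not_zless by simp
  then obtain x where x: "x \<in> L" "k *s x \<notin> L0" using assms(1) by (auto simp: has_level_def)
  moreover have "l *s x \<in> L0" using assms(1) x(1) by (auto simp: has_level_def)
  hence "2 *s (k *s x) \<in> L0" by (simp add: k)
  ultimately show ?thesis using that lattice_scale[OF assms(3)] by blast
qed

text \<open>The generator of \<open>psi_generator\<close> spans \<open>L\<close> only up to elements
  of order 2. For odd \<open>l\<close> there are none. For even \<open>l\<close> there is one class
  \<open>t\<close>, and it suffices that \<open>t\<close> be a multiple of the generator modulo
  \<open>L0\<close>.\<close>

lemma cyclic_generator:
  assumes L: "char_lattice L" and l: "has_level L l"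
  obtains N g where "0 < N" "\<And>k. N dvd k \<longleftrightarrow> l dvd 2 * k" "g \<in> L"
    "psi (2 *s g) - 1 / of_int N \<in> \<int>" "\<And>x. x \<in> L \<Longrightarrow> \<exists>a. x - a *s g \<in> L0"
proof -
  obtain N g where N: "0 < N" "\<And>k. N dvd k \<longleftrightarrow> l dvd 2 * k"
    and g: "g \<in> L" "psi (2 *s g) - 1 / of_int N \<in> \<int>" "\<And>x. x \<in> L \<Longrightarrow> \<exists>a. 2 *s (x - a *s g) \<in> L0"
    using psi_generator[OF L l] by blast
  note L_intros = lattice_intros[OF L] and result = that
  show ?thesis
  proof (cases "even l")
    case False
    have "\<exists>a. x - a *s g \<in> L0" if x: "x \<in> L" for x
    proof -
      obtain a where a: "2 *s (x - a *s g) \<in> L0" using g(3)[OF x] by blast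
      have "l *s (x - a *s g) \<in> L0" using x g(1) by (intro has_levelD[OF l] L_intros)
      with False a show ?thesis using odd_level_two_torsion by blast
    qed
    with N g(1,2) show ?thesis by (rule that)
  next
    case True
    with l obtain t where t: "t \<in> L" "2 *s t \<in> L0" "t \<notin> L0"
      using L by (rule even_level_two_torsion)
    have tors: "w \<in> L0 \<or> w - t \<in> L0" if "w \<in> L" "2 *s w \<in> L0" for w
      using that t two_torsion_unique[OF L _ _ _ L] by blast
    have finish: thesis if g': "g' \<in> L" "psi (2 *s g') - 1 / of_int N \<in> \<int>"
      "\<And>x. x \<in> L \<Longrightarrow> \<exists>a. 2 *s (x - a *s g') \<in> L0" "t - b *s g' \<in> L0" for g' b
    proof (rule result[OF N g'(1,2)])
      fix x assume x: "x \<in> L"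
      obtain a where a: "2 *s (x - a *s g') \<in> L0" using g'(3)[OF x] by blast
      from tors[OF _ a] show "\<exists>a. x - a *s g' \<in> L0"
      proof
        assume *: "x - a *s g' - t \<in> L0"
        have "x - (a + b) *s g' = (x - a *s g' - t) + (t - b *s g')"
          by (simp add: scale_left_distrib)
        also have "\<dots> \<in> L0" using * g'(4) by (rule lattice_add[OF L0])
        finally show ?thesis by blast
      next
        show "x - a *s g' \<in> L" using x g'(1) by (intro L_intros)
      qed blast
    qed
    show ?thesis
    proof (cases "\<exists>b. t - b *s g \<in> L0")
      case True
      thus ?thesis using finish g by blast
    next
      case False
      have lN: "l dvd 2 * N" using N(2)[of N] by simp
      have "(2 * N) *s g \<in> L0" using l g(1) lN unfolding has_level_def by blast
      hence "N *s g \<in> L0 \<or> N *s g - t \<in> L0" using g(1) by (intro tors L_intros) simp_all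
      moreover have "N *s g - t \<notin> L0"
      proof
        assume "N *s g - t \<in> L0"
        from lattice_diff[OF L0 lattice_zero[OF L0] this] show False using False by auto
      qed
      ultimately have Ng: "N *s g \<in> L0" by blast
      \<comment> \<open>For \<open>N = 2 * k\<close> the value \<open>psi (N *s g)\<close> would be
        1/2 modulo 1, although \<open>N *s g\<close> lies in \<open>L0\<close>.\<close>
      have "odd N"
      proof
        assume "even N"
        then obtain k where k: "N = 2 * k" by (rule evenE)
        have "psi (N *s g) = of_int k * psi (2 *s g)" by (simp add: psi_scale k)
        hence "of_int k * psi (2 *s g) \<in> \<int>" using psi_L0[OF Ng] by simp
        moreover have "of_int k * (psi (2 *s g) - 1 / of_int N) \<in> \<int>"
          using g(2) by (intro Ints_mult Ints_of_int)
        ultimately have "of_int k * psi (2 *s g) - of_int k * (psi (2 *s g) - 1 / of_int N) \<in> \<int>"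
          by (rule Ints_diff)
        hence "of_int 1 / 2 \<in> (\<int> :: rat set)" using N(1) by (simp add: k algebra_simps)
        thus False unfolding half_Ints_iff_even by simp
      qed
      then obtain k where k: "N = 2 * k + 1" by (rule oddE)
      have psi_t: "psi (2 *s t) \<in> \<int>" using t(2) by (rule psi_L0)
      show ?thesis
      \<comment> \<open>Replacing \<open>g\<close> by \<open>g + t\<close> preserves the value of
        \<open>psi\<close> modulo 1, and since \<open>N\<close> is odd, \<open>N *s (g + t)\<close>
        is \<open>t\<close> modulo \<open>L0\<close>.\<close>
      proof (rule finish)
        show "g + t \<in> L" using g(1) t(1) by (rule lattice_add[OF L])
        have "psi (2 *s g) - 1 / of_int N + psi (2 *s t) \<in> \<int>" using g(2) psi_t by (rule Ints_add)
        thus "psi (2 *s (g + t)) - 1 / of_int N \<in> \<int>"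
          by (simp add: scale_right_distrib psi_add algebra_simps)
        have "t - N *s (g + t) = 0 - N *s g - k *s (2 *s t)"
          by (simp add: k scale_left_distrib scale_right_distrib mult.commute)
        also have "\<dots> \<in> L0"
          using Ng t(2) lattice_zero[OF L0] lattice_diff[OF L0] lattice_scale[OF L0] by blast
        finally show "t - N *s (g + t) \<in> L0" .
        show "\<exists>a. 2 *s (x - a *s (g + t)) \<in> L0" if x: "x \<in> L" for x
        proof -
          obtain a where a: "2 *s (x - a *s g) \<in> L0" using g(3)[OF x] by blast
          have "2 *s (x - a *s (g + t)) = 2 *s (x - a *s g) - a *s (2 *s t)"
            by (simp add: scale_right_distrib scale_right_diff_distrib mult.commute)
          also have "\<dots> \<in> L0" using a t(2) lattice_diff[OF L0] lattice_scale[OF L0] by blast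
          finally show ?thesis by blast
        qed
      qed
    qed
  qed
qed

lemma T_funpow_eigen:
  assumes "T g - b *s g \<in> L0"
  shows "(T ^^ j) g - (b ^ j) *s g \<in> L0"
proof (induction j)
  case 0
  thus ?case by (simp add: L0_intros)
next
  case (Suc j)
  have "(T ^^ Suc j) g - (b ^ Suc j) *s g
      = T ((T ^^ j) g - (b ^ j) *s g) + (b ^ j) *s (T g - b *s g)"
    by (simp add: T_diff T_scale scale_right_diff_distrib mult.commute)
  also have "\<dots> \<in> L0"
    using Suc assms by (intro lattice_add[OF L0] lattice_T[OF L0] lattice_scale[OF L0])
  finally show ?case .
qed

text \<open>The number \<open>N\<close> depends only on \<open>l\<close>, so generators
  \<open>g1\<close> and \<open>g2\<close> can be taken with equal \<open>psi (2 *s g)\<close> modulo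
  1, and \<open>w = g1 - g2\<close> has order at most 2. If its double \<open>z\<close> satisfies
  \<open>quad\<close>, then \<open>w\<close> is 0 or \<open>t\<close> modulo \<open>L0\<close>,
  where \<open>t\<close> lies in \<open>L2\<close>; otherwise \<open>no_eigenvector\<close>
  applies.\<close>

lemma generator_mod_L0:
  assumes L1: "char_lattice L1" "has_level L1 l" and L2: "char_lattice L2" "has_level L2 l"
  obtains g y where "g \<in> L1" "\<And>x. x \<in> L1 \<Longrightarrow> \<exists>a. x - a *s g \<in> L0" "y \<in> L2" "g - y \<in> L0"
proof -
  obtain N1 g1 where N1: "0 < N1" "\<And>k. N1 dvd k \<longleftrightarrow> l dvd 2 * k"
    and g1: "g1 \<in> L1" "psi (2 *s g1) - 1 / of_int N1 \<in> \<int>" "\<And>x. x \<in> L1 \<Longrightarrow> \<exists>a. x - a *s g1 \<in> L0"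
    using cyclic_generator[OF L1] by blast
  obtain N2 g2 where N2: "0 < N2" "\<And>k. N2 dvd k \<longleftrightarrow> l dvd 2 * k"
    and g2: "g2 \<in> L2" "psi (2 *s g2) - 1 / of_int N2 \<in> \<int>" "\<And>x. x \<in> L2 \<Longrightarrow> \<exists>a. x - a *s g2 \<in> L0"
    using cyclic_generator[OF L2] by blast
  have "N1 dvd N2" "N2 dvd N1" using N1(2) N2(2) dvd_refl by blast+
  hence N: "N1 = N2" using N1(1) N2(1) by (simp add: zdvd_antisym_nonneg)
  define w where "w = g1 - g2"
  define z where "z = 2 *s w"
  note L1_intros = lattice_intros[OF L1(1)] and L2_intros = lattice_intros[OF L2(1)]
  have w_dual: "B w ((T ^^ j) e) \<in> \<int>" for j
    using g1(1) g2(1) L1_intros L2_intros lattice_int[OF L1(1)] lattice_int[OF L2(1)]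
    by (simp add: w_def B_simps)
  have "psi (2 *s w) \<in> \<int>"
    using Ints_diff[OF g1(2) g2(2)] by (simp add: w_def psi_diff psi_scale N algebra_simps)
  hence z: "z \<in> L0" unfolding z_def using w_dual by (intro psi_two)
  have perp: "perp z" using z w_dual by (simp add: perp_def z_def B_simps)
  have "\<exists>y\<in>L2. g1 - y \<in> L0"
  proof (cases "w \<in> L0")
    case True
    thus ?thesis using g2(1) by (auto simp: w_def)
  next
    case w: False
    have "even l"
    proof (rule ccontr)
      assume odd: "odd l"
      have "l *s g1 - l *s g2 \<in> L0"
        using has_levelD[OF L1(2) g1(1)] has_levelD[OF L2(2) g2(1)] by (rule lattice_diff[OF L0])
      hence "l *s w \<in> L0" by (simp add: w_def scale_right_diff_distrib)
      with odd w z show False using odd_level_two_torsion unfolding z_def by blast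
    qed
    with L2(2) obtain t where t: "t \<in> L2" "2 *s t \<in> L0" "t \<notin> L0"
      using L2(1) by (rule even_level_two_torsion)
    have quad_t: "quad (2 *s t)" "2 *s t \<notin> mult 2"
      by (rule quad_two[OF L2(1) t(1,2)], rule contrapos_nn[OF t(3)], erule mult_cancel, simp)
    have "quad z"
    proof (rule ccontr)
      assume nq: "\<not> quad z"
      \<comment> \<open>On the cyclic quotient of \<open>L2\<close>, \<open>T\<close> acts as
        multiplication by an integer.\<close>
      obtain b where b: "T g2 - b *s g2 \<in> L0" using g2(3)[OF lattice_T[OF L2(1) g2(1)]] by blast
      define \<beta> where "\<beta> = B z g2"
      \<comment> \<open>Expand the integral values \<open>B g1 ((T ^^ j) g1)\<close> and
        \<open>B g2 ((T ^^ j) g2)\<close> with \<open>g1 = w + g2\<close>, and replace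
        \<open>(T ^^ j) g2\<close> by \<open>(b ^ j) *s g2\<close> up to a vector of
        \<open>L0\<close>.\<close>
      have rel: "B z ((T ^^ j) z) / 4 + of_int (b ^ j) * \<beta> \<in> \<int>" for j
      proof -
        have "(T ^^ j) (x + y) = (T ^^ j) x + (T ^^ j) y" "(T ^^ j) (a *s x) = a *s (T ^^ j) x" for x y a
          unfolding act_monom[symmetric] by (rule act_add_right act_scale_right)+
        note Tj = this
        have "g1 = w + g2" by (simp add: w_def)
        hence "B g1 ((T ^^ j) g1) = B w ((T ^^ j) w) + B w ((T ^^ j) g2) + B g2 ((T ^^ j) w) + B g2 ((T ^^ j) g2)"
          by (simp add: Tj B_simps)
        moreover have "B g2 ((T ^^ j) w) = B w ((T ^^ j) g2)"
          by (metis B_sym T_funpow_adjoint)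
        ultimately have "B z ((T ^^ j) z) / 4 + of_int (b ^ j) * \<beta>
            = B g1 ((T ^^ j) g1) - B g2 ((T ^^ j) g2) - B z ((T ^^ j) g2 - (b ^ j) *s g2)"
          by (simp add: \<beta>_def z_def Tj B_simps)
        also have "\<dots> \<in> \<int>"
          using g1(1) g2(1) L1_intros L2_intros lattice_int[OF L1(1)] lattice_int[OF L2(1)]
            L0_B_int[OF z T_funpow_eigen[OF b]]
          by (intro Ints_diff) auto
        finally show ?thesis .
      qed
      have two_\<beta>: "2 * \<beta> \<in> \<int>"
      proof -
        have "2 * (B z ((T ^^ 0) z) / 4 + of_int (b ^ 0) * \<beta>) - B z ((T ^^ 0) z) / 2 \<in> \<int>"
          using rel[of 0] perp_B_perp_even[OF perp perp, of 0] by (intro Ints_diff Ints_mult) simp_all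
        thus ?thesis by simp
      qed
      \<comment> \<open>An integral \<open>\<beta>\<close> would give \<open>quad z\<close>. As
        \<open>2 * \<beta>\<close> is integral, \<open>\<beta>\<close> is 1/2 modulo 1, which is the
        congruence required by \<open>no_eigenvector\<close>.\<close>
      have "\<beta> \<notin> \<int>"
      proof
        assume \<beta>: "\<beta> \<in> \<int>"
        have "B z ((T ^^ j) z) / 4 \<in> \<int>" for j
        proof -
          have "of_int (b ^ j) * \<beta> \<in> \<int>" using \<beta> by (intro Ints_mult Ints_of_int)
          from Ints_diff[OF rel[of j] this] show ?thesis by simp
        qed
        thus False using nq perp by (simp add: quad_def)
      qed
      obtain q where q: "2 * \<beta> = of_int q" using two_\<beta> by (rule Ints_cases)
      hence \<beta>_q: "\<beta> = of_int q / 2" by simp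
      hence "odd q" using \<open>\<beta> \<notin> \<int>\<close> half_Ints_iff_even by metis
      hence "(of_int (q + 1) :: rat) / 2 \<in> \<int>" unfolding half_Ints_iff_even by simp
      hence \<beta>_half: "\<beta> + 1 / 2 \<in> \<int>" by (simp add: \<beta>_q add_divide_distrib)
      have "(B z ((T ^^ j) z) - 2 * of_int (b ^ j)) / 4 \<in> \<int>" for j
      proof -
        have "of_int (b ^ j) * (\<beta> + 1 / 2) \<in> \<int>" using \<beta>_half by (intro Ints_mult Ints_of_int)
        from Ints_diff[OF rel[of j] this] show ?thesis
          by (simp add: distrib_left diff_divide_distrib)
      qed
      \<comment> \<open>Modulo \<open>L0\<close> the vector \<open>t\<close> is a multiple of
        \<open>g2\<close> and inherits its eigenvalue \<open>b\<close>.\<close>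
      moreover have "T (2 *s t) - b *s (2 *s t) \<in> mult 2"
      proof -
        obtain a where a: "t - a *s g2 \<in> L0" using g2(3) t(1) by blast
        have "T t - b *s t = T (t - a *s g2) - b *s (t - a *s g2) + a *s (T g2 - b *s g2)"
          by (simp add: T_diff T_scale scale_right_diff_distrib mult.commute)
        also have "\<dots> \<in> L0"
          by (intro lattice_add[OF L0] lattice_diff[OF L0 lattice_T[OF L0 a]] lattice_scale[OF L0 b]
              lattice_scale[OF L0 a])
        finally have "2 *s (T t - b *s t) \<in> mult 2" by (rule mult_scaleI)
        thus ?thesis by (simp add: T_scale scale_right_diff_distrib mult.commute)
      qed
      ultimately show False using no_eigenvector[OF quad_t _ perp] by blast
    qed
    moreover have "z \<notin> mult 2"
      unfolding z_def by (rule contrapos_nn[OF w], erule mult_cancel, simp)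
    ultimately have "z - 2 *s t \<in> mult 2" using quad_t by (intro quad_unique)
    hence "2 *s (w - t) \<in> mult 2" by (simp add: z_def scale_right_diff_distrib)
    hence "w - t \<in> L0" by (rule mult_cancel) simp
    hence "g1 - (g2 + t) \<in> L0" by (simp add: w_def algebra_simps)
    thus ?thesis using lattice_add[OF L2(1) g2(1) t(1)] by blast
  qed
  thus ?thesis using that g1 by blast
qed

theorem lattice_subset:
  assumes L1: "char_lattice L1" "has_level L1 l" and L2: "char_lattice L2" "has_level L2 l"
  shows "L2 \<subseteq> L1"
proof
  fix x assume x: "x \<in> L2"
  obtain g y where g: "g \<in> L1" "\<And>x. x \<in> L1 \<Longrightarrow> \<exists>a. x - a *s g \<in> L0" and y: "y \<in> L2" "g - y \<in> L0"
    using generator_mod_L0[OF L1 L2] by blast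
  obtain g' y' where g': "g' \<in> L2" "\<And>x. x \<in> L2 \<Longrightarrow> \<exists>a. x - a *s g' \<in> L0"
    and y': "y' \<in> L1" "g' - y' \<in> L0"
    using generator_mod_L0[OF L2 L1] by blast
  define z where "z = g - y"
  have z: "z \<in> L0" using y(2) by (simp add: z_def)
  have gyz: "g = y + z" by (simp add: z_def)
  have yz: "B y z \<in> \<int>"
  proof -
    \<comment> \<open>Polarization of the quadratic function \<open>(B x x - B x e) / 2\<close>,
      which is integral on each of the three lattices.\<close>
    have "B y z = (B g g - B g e) / 2 - (B y y - B y e) / 2 - (B z z - B z e) / 2"
      by (simp add: gyz B_simps B_sym[of z y] field_simps)
    also have "\<dots> \<in> \<int>"
      by (intro Ints_diff lattice_char[OF L1(1) g(1)] lattice_char[OF L2(1) y(1)] lattice_char[OF L0 z])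
    finally show ?thesis .
  qed
  obtain a1 where a1: "x - a1 *s g' \<in> L0" using g'(2)[OF x] by blast
  obtain a2 where a2: "y' - a2 *s g \<in> L0" using g(2)[OF y'(1)] by blast
  define c where "c = a1 * a2"
  \<comment> \<open>Modulo \<open>L0\<close>, \<open>x\<close> is successively a multiple of
    \<open>g'\<close>, of \<open>y'\<close>, of \<open>g\<close> and of \<open>y\<close>. It remains
    to pair \<open>x = c *s y + x'\<close> with \<open>v = a *s g + v'\<close>; the only product not
    integral for lattice reasons is \<open>B y z\<close>.\<close>
  have "x - c *s y = (x - a1 *s g') + a1 *s (g' - y') + a1 *s (y' - a2 *s g) + c *s z"
    by (simp add: c_def z_def scale_right_diff_distrib)
  also have "\<dots> \<in> L0"
    by (intro lattice_add[OF L0] a1 lattice_scale[OF L0 a2] lattice_scale[OF L0 y'(2)] lattice_scale[OF L0 z])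
  finally have x0: "x - c *s y \<in> L0" .
  have x0': "x - c *s y \<in> L2" using x y(1) by (intro lattice_intros[OF L2(1)])
  define x' where "x' = x - c *s y"
  have "B x v \<in> \<int>" if v: "v \<in> L1" for v
  proof -
    obtain a where a: "v - a *s g \<in> L0" using g(2)[OF v] by blast
    define v' where "v' = v - a *s g"
    have v': "v' \<in> L0" "v' \<in> L1"
      unfolding v'_def by (rule a, intro lattice_intros[OF L1(1)] v g(1))
    have xz: "B x z = of_int c * B y z + B x' z" "B x v' = of_int c * (B g v' - B z v') + B x' v'"
      by (simp_all add: x'_def gyz B_simps)
    have "B x v = of_int a * (B x y + B x z) + B x v'"
      by (simp add: v'_def gyz B_simps algebra_simps)
    moreover have "B x y \<in> \<int>" "B g v' \<in> \<int>" "B z v' \<in> \<int>" "B x' z \<in> \<int>" "B x' v' \<in> \<int>"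
      using lattice_int[OF L2(1) x y(1)] lattice_int[OF L1(1) g(1) v'(2)] L0_B_int x0 z v'(1)
      by (simp_all add: x'_def)
    ultimately show ?thesis unfolding xz using yz by simp
  qed
  thus "x \<in> L1" using lattice_dual[OF L1(1)] by blast
qed

end

subsection \<open>Lattices in rational coordinate space\<close>

lemma sum_fun_apply: "sum f S i = (\<Sum>k\<in>S. f k i)" for f :: "'a \<Rightarrow> 'b \<Rightarrow> 'c::comm_monoid_add"
  by (induction S rule: infinite_finite_induct) (simp_all add: zero_fun_def)

text \<open>Vectors are functions on all naturals. Coordinates from \<open>n\<close> on are ignored
  by \<open>dot n\<close> and left unrestricted in the lattices.\<close>

definition int_scale :: "int \<Rightarrow> (nat \<Rightarrow> rat) \<Rightarrow> nat \<Rightarrow> rat" where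
  "int_scale a x = (\<lambda>i. of_int a * x i)"

definition dot :: "nat \<Rightarrow> (nat \<Rightarrow> rat) \<Rightarrow> (nat \<Rightarrow> rat) \<Rightarrow> rat" where
  "dot n x y = (\<Sum>i<n. x i * y i)"

definition lin :: "nat \<Rightarrow> (nat \<Rightarrow> nat \<Rightarrow> rat) \<Rightarrow> (nat \<Rightarrow> rat) \<Rightarrow> nat \<Rightarrow> rat" where
  "lin n A x = (\<lambda>i. \<Sum>j<n. A i j * x j)"

lemma self_adjoint_module_lin:
  assumes "\<And>i j. i < n \<Longrightarrow> j < n \<Longrightarrow> A i j = A j i"
  shows "self_adjoint_module int_scale (dot n) (lin n A)"
proof
  fix x y
  have "dot n (lin n A x) y = (\<Sum>i<n. \<Sum>j<n. A i j * x j * y i)"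
    by (simp add: dot_def lin_def sum_distrib_right)
  also have "\<dots> = (\<Sum>j<n. \<Sum>i<n. A j i * x j * y i)"
    by (subst sum.swap) (auto intro!: sum.cong simp: assms)
  also have "\<dots> = dot n x (lin n A y)"
    by (simp add: dot_def lin_def sum_distrib_left mult_ac)
  finally show "dot n (lin n A x) y = dot n x (lin n A y)" .
qed (auto simp: int_scale_def dot_def lin_def plus_fun_def fun_eq_iff algebra_simps sum.distrib
    sum_distrib_left)

text \<open>The diagonal vanishes and the off-diagonal terms come in equal pairs.\<close>

lemma even_quadratic_form:
  fixes C :: "nat \<Rightarrow> nat \<Rightarrow> int"
  assumes "\<And>i j. i < n \<Longrightarrow> j < n \<Longrightarrow> C i j = C j i" and "\<And>i. i < n \<Longrightarrow> C i i = 0"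
  shows "even (\<Sum>i<n. \<Sum>j<n. C i j * y i * y j)"
  using assms
proof (induction n)
  case (Suc n)
  have "(\<Sum>i<n. C i n * y i * y n) = (\<Sum>j<n. C n j * y n * y j)"
    using Suc.prems(1)[of _ n] by (intro sum.cong) (simp_all add: mult_ac)
  hence "(\<Sum>i<Suc n. \<Sum>j<Suc n. C i j * y i * y j)
      = (\<Sum>i<n. \<Sum>j<n. C i j * y i * y j) + 2 * (\<Sum>j<n. C n j * y n * y j)"
    using Suc.prems(2)[of n] by (simp add: sum.distrib)
  thus ?case using Suc.IH Suc.prems by simp
qed simp

text \<open>The coordinate map \<open>y\<close> is the identity for the standard lattice and \<open>x \<mapsto> Q\<^sup>T x\<close> for the
  lattice spanned by the columns of \<open>Q\<close>; \<open>C\<close> is then the matrix of \<open>A\<close> in these coordinates.\<close>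

lemma char_lattice_coordinates:
  fixes C :: "nat \<Rightarrow> nat \<Rightarrow> int" and y :: "(nat \<Rightarrow> rat) \<Rightarrow> nat \<Rightarrow> rat"
  assumes A: "\<And>i j. i < n \<Longrightarrow> j < n \<Longrightarrow> A i j = A j i"
    and C: "\<And>i j. i < n \<Longrightarrow> j < n \<Longrightarrow> C i j = C j i" "\<And>i. i < n \<Longrightarrow> C i i = 0"
    and isometry: "\<And>x x'. dot n x x' = (\<Sum>k<n. y x k * y x' k)"
    and lin: "\<And>x k. k < n \<Longrightarrow> y (lin n A x) k = (\<Sum>l<n. of_int (C k l) * y x l)"
    and e: "\<And>k. k < n \<Longrightarrow> y e k = 1"
    and basis: "\<And>k l. k < n \<Longrightarrow> l < n \<Longrightarrow> y (q k) l = of_bool (k = l)"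
  shows "self_adjoint_module.char_lattice (dot n) (lin n A) e {x. \<forall>k<n. y x k \<in> \<int>}"
    (is "self_adjoint_module.char_lattice _ _ _ ?L")
proof -
  interpret self_adjoint_module int_scale "dot n" "lin n A" e
    by (rule self_adjoint_module_lin[OF A])
  show ?thesis
    unfolding char_lattice_def
  proof (intro conjI ballI allI)
    fix x
    show "x \<in> ?L \<longleftrightarrow> (\<forall>x'\<in>?L. dot n x x' \<in> \<int>)"
    proof
      assume "x \<in> ?L"
      thus "\<forall>x'\<in>?L. dot n x x' \<in> \<int>" by (auto simp: isometry intro!: Ints_sum)
    next
      assume *: "\<forall>x'\<in>?L. dot n x x' \<in> \<int>"
      have "y x k \<in> \<int>" if k: "k < n" for k
      proof -
        \<comment> \<open>Pairing with the basis vector \<open>q k\<close> isolates the coordinate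
          \<open>k\<close>.\<close>
        have "q k \<in> ?L" using k by (simp add: basis)
        hence "dot n x (q k) \<in> \<int>" using * by blast
        moreover have "dot n x (q k) = (\<Sum>l<n. if k = l then y x l else 0)"
          unfolding isometry using k by (intro sum.cong) (auto simp: basis)
        ultimately show ?thesis using k by simp
      qed
      thus "x \<in> ?L" by simp
    qed
  next
    fix x assume x: "x \<in> ?L"
    hence yx: "y x k \<in> \<int>" if "k < n" for k using that by simp
    thus "lin n A x \<in> ?L" by (auto simp: lin intro!: Ints_sum)
    define z where "z k = \<lfloor>y x k\<rfloor>" for k
    have z: "y x k = of_int (z k)" if "k < n" for k
      using yx[OF that] by (simp add: z_def)
    have "dot n x x - dot n x e = (\<Sum>k<n. of_int (z k * (z k - 1)))"
      by (simp add: isometry sum_subtractf[symmetric] e z algebra_simps)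
    also have "\<dots> = of_int (\<Sum>k<n. z k * (z k - 1))" by simp
    finally have "dot n x x - dot n x e = of_int (\<Sum>k<n. z k * (z k - 1))" .
    moreover have "even (\<Sum>k<n. z k * (z k - 1))" by (intro dvd_sum) auto
    ultimately show "(dot n x x - dot n x e) / 2 \<in> \<int>" by (simp only: half_Ints_iff_even)
    have "dot n (lin n A x) x = (\<Sum>i<n. \<Sum>j<n. of_int (C i j * z i * z j))"
      by (simp add: isometry lin z sum_distrib_left sum_distrib_right mult_ac)
    also have "\<dots> = of_int (\<Sum>i<n. \<Sum>j<n. C i j * z i * z j)" by simp
    finally show "dot n (lin n A x) x / 2 \<in> \<int>"
      using even_quadratic_form[of n C z] C by (simp only: half_Ints_iff_even)
  next
    show "e \<in> ?L" by (simp add: e)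
  qed
qed

abbreviation std_lattice :: "nat \<Rightarrow> (nat \<Rightarrow> rat) set" where
  "std_lattice n \<equiv> {x. \<forall>i<n. x i \<in> \<int>}"

lemma int_scale_std_lattice_iff:
  assumes "k \<noteq> 0"
  shows "x \<in> int_scale k ` std_lattice n \<longleftrightarrow> (\<forall>i<n. x i / of_int k \<in> \<int>)"
proof
  assume "\<forall>i<n. x i / of_int k \<in> \<int>"
  thus "x \<in> int_scale k ` std_lattice n"
    using assms by (intro image_eqI[of _ _ "\<lambda>i. x i / of_int k"]) (auto simp: int_scale_def)
qed (use assms in \<open>auto simp: int_scale_def\<close>)

lemma sum_of_bool_mult_left: "finite S \<Longrightarrow> i \<in> S \<Longrightarrow> (\<Sum>j\<in>S. of_bool (i = j) * f j) = f i"
  for f :: "'a \<Rightarrow> 'b::semiring_1"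
  by (simp add: of_bool_def if_distrib[where f = "\<lambda>c. c * _"] sum.delta cong: if_cong)

section \<open>Coordinates adapted to the Smith normal form\<close>

text \<open>The equation \<open>U * W * V = diag \<delta>\<close> for the walk matrix \<open>W\<close> is used in the two forms
  \<open>W * V = U' * diag \<delta>\<close> and \<open>U * W = diag \<delta> * V'\<close>, where \<open>U'\<close> and \<open>V'\<close> are the inverses.\<close>

locale smith_walk =
  fixes n :: nat and A :: "nat \<Rightarrow> nat \<Rightarrow> rat" and W U U' V V' :: "nat \<Rightarrow> nat \<Rightarrow> int"
    and \<delta> :: "nat \<Rightarrow> int"
  assumes n_ge_2: "2 \<le> n"
    and A_sym: "\<And>i j. i < n \<Longrightarrow> j < n \<Longrightarrow> A i j = A j i"
    and std: "self_adjoint_module.char_lattice (dot n) (lin n A) 1 (std_lattice n)"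
    and W: "\<And>i k. i < n \<Longrightarrow> k < n \<Longrightarrow> of_int (W i k) = (lin n A ^^ k) 1 i"
    and WV: "\<And>i j. i < n \<Longrightarrow> j < n \<Longrightarrow> (\<Sum>k<n. W i k * V k j) = U' i j * \<delta> j"
    and UW: "\<And>j k. j < n \<Longrightarrow> k < n \<Longrightarrow> (\<Sum>i<n. U j i * W i k) = \<delta> j * V' j k"
    and U'U: "\<And>i l. i < n \<Longrightarrow> l < n \<Longrightarrow> (\<Sum>j<n. U' i j * U j l) = of_bool (i = l)"
    and VV': "\<And>k l. k < n \<Longrightarrow> l < n \<Longrightarrow> (\<Sum>j<n. V k j * V' j l) = of_bool (k = l)"
    and \<delta>_pos: "\<And>j. j < n \<Longrightarrow> 0 < \<delta> j"
    and \<delta>_one: "\<And>j. j < n - n div 2 \<Longrightarrow> \<delta> j = 1"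
    and \<delta>_two: "\<And>j. j < n - 1 \<Longrightarrow> \<delta> j dvd 2"
begin

abbreviation T :: "(nat \<Rightarrow> rat) \<Rightarrow> nat \<Rightarrow> rat" where
  "T \<equiv> lin n A"

sublocale self_adjoint_module int_scale "dot n" T 1
  by (rule self_adjoint_module_lin[OF A_sym])

text \<open>The coordinates of \<open>x\<close>, as a row vector, with respect to the rows of
  \<open>U\<close>.\<close>

definition y :: "(nat \<Rightarrow> rat) \<Rightarrow> nat \<Rightarrow> rat" where
  "y x j = (\<Sum>i<n. x i * of_int (U' i j))"

lemma y_add: "y (x + x') j = y x j + y x' j"
  by (simp add: y_def distrib_right sum.distrib)

lemma y_diff: "y (x - x') j = y x j - y x' j"
  by (simp add: y_def left_diff_distrib sum_subtractf)

lemma y_scale: "y (int_scale a x) j = of_int a * y x j"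
  by (simp add: y_def int_scale_def sum_distrib_left mult_ac)

lemma y_inverse:
  assumes "i < n"
  shows "x i = (\<Sum>j<n. y x j * of_int (U j i))"
proof -
  have "(\<Sum>j<n. y x j * of_int (U j i)) = (\<Sum>j<n. \<Sum>l<n. x l * of_int (U' l j * U j i))"
    by (simp add: y_def sum_distrib_left sum_distrib_right mult_ac)
  also have "\<dots> = (\<Sum>l<n. x l * of_int (\<Sum>j<n. U' l j * U j i))"
    by (subst sum.swap) (simp add: sum_distrib_left)
  also have "\<dots> = (\<Sum>l<n. of_bool (i = l) * x l)"
    using assms by (intro sum.cong) (auto simp: U'U)
  also have "\<dots> = x i" using assms by (intro sum_of_bool_mult_left) auto
  finally show ?thesis ..
qed

lemma y_Ints: "x \<in> std_lattice n \<Longrightarrow> y x j \<in> \<int>"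
  by (auto simp: y_def intro!: Ints_sum)

lemma divisible_by_coordinates:
  assumes "\<And>j. j < n \<Longrightarrow> y x j / k \<in> \<int>" "i < n"
  shows "x i / k \<in> \<int>"
proof -
  have "x i / k = (\<Sum>j<n. y x j / k * of_int (U j i))"
    using y_inverse[OF assms(2), of x] by (simp add: sum_divide_distrib)
  also have "\<dots> \<in> \<int>" using assms(1) by (intro Ints_sum Ints_mult) auto
  finally show ?thesis .
qed

text \<open>Multiply \<open>W * V = U' * diag \<delta>\<close> by the row vector \<open>x\<close>:
  integral pairings with the walk vectors bound the denominator of the coordinate \<open>j\<close>
  by \<open>\<delta> j\<close>.\<close>

lemma \<delta>_y:
  assumes "j < n"
  shows "of_int (\<delta> j) * y x j = (\<Sum>k<n. of_int (V k j) * dot n x ((T ^^ k) 1))"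
proof -
  have "of_int (\<delta> j) * y x j = (\<Sum>i<n. x i * of_int (U' i j * \<delta> j))"
    by (simp add: y_def sum_distrib_left mult_ac)
  also have "\<dots> = (\<Sum>i<n. x i * of_int (\<Sum>k<n. W i k * V k j))"
    using assms by (intro sum.cong) (simp_all add: WV del: of_int_sum)
  also have "\<dots> = (\<Sum>i<n. \<Sum>k<n. of_int (V k j) * (x i * of_int (W i k)))"
    by (simp add: sum_distrib_left mult_ac)
  also have "\<dots> = (\<Sum>k<n. \<Sum>i<n. of_int (V k j) * (x i * (T ^^ k) 1 i))"
    by (subst sum.swap) (simp add: W)
  finally show ?thesis by (simp add: dot_def sum_distrib_left)
qed

lemma \<delta>_y_divisible:
  assumes "j < n" "\<And>k. dot n x ((T ^^ k) 1) / c \<in> \<int>"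
  shows "of_int (\<delta> j) * y x j / c \<in> \<int>"
proof -
  have "of_int (\<delta> j) * y x j / c = (\<Sum>k<n. of_int (V k j) * (dot n x ((T ^^ k) 1) / c))"
    by (simp add: \<delta>_y[OF assms(1)] sum_divide_distrib)
  also have "\<dots> \<in> \<int>" using assms(2) by (intro Ints_sum Ints_mult) auto
  finally show ?thesis .
qed

text \<open>The coefficient vector of \<open>p\<close> multiplied by \<open>V'\<close>. For degree
  below \<open>n\<close>, \<open>U\<close> times \<open>act p 1\<close> has the entries
  \<open>\<delta> j * c p j\<close>.\<close>

definition c :: "int poly \<Rightarrow> nat \<Rightarrow> int" where
  "c p j = (\<Sum>k<n. V' j k * coeff p k)"

lemma c_diff: "c (p - q) j = c p j - c q j"
  by (simp add: c_def right_diff_distrib sum_subtractf)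

lemma two_dvd_if_c_even:
  assumes "degree p < n" "\<And>j. j < n \<Longrightarrow> even (c p j)"
  shows "2 dvd p"
proof -
  have "even (coeff p k)" for k
  proof (cases "k < n")
    case True
    have "(\<Sum>j<n. V k j * c p j) = (\<Sum>j<n. \<Sum>l<n. V k j * V' j l * coeff p l)"
      by (simp add: c_def sum_distrib_left mult_ac)
    also have "\<dots> = (\<Sum>l<n. (\<Sum>j<n. V k j * V' j l) * coeff p l)"
      by (subst sum.swap) (simp add: sum_distrib_right)
    also have "\<dots> = (\<Sum>l<n. of_bool (k = l) * coeff p l)"
      using True by (intro sum.cong) (auto simp: VV')
    also have "\<dots> = coeff p k" using True by (intro sum_of_bool_mult_left) auto
    finally have "coeff p k = (\<Sum>j<n. V k j * c p j)" ..
    also have "even \<dots>" using assms(2) by (intro dvd_sum) auto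
    finally show ?thesis .
  next
    case False
    thus ?thesis using assms(1) by (simp add: coeff_eq_0)
  qed
  thus ?thesis by (simp add: two_dvd_poly_iff)
qed

lemma \<delta>_c_dvd:
  assumes "degree p < n" "act p 1 \<in> int_scale k ` std_lattice n" "k \<noteq> 0" "j < n"
  shows "k dvd \<delta> j * c p j"
proof -
  have act: "act p 1 i = (\<Sum>l<n. of_int (coeff p l * W i l))" if "i < n" for i
    using that by (simp add: act_eq_sum[OF assms(1)] sum_fun_apply int_scale_def W)
  have "(\<Sum>i<n. of_int (U j i) * act p 1 i) = (\<Sum>i<n. \<Sum>l<n. of_int (coeff p l * (U j i * W i l)))"
    by (simp add: act sum_distrib_left mult_ac)
  also have "\<dots> = (\<Sum>l<n. of_int (coeff p l * (\<Sum>i<n. U j i * W i l)))"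
    by (subst sum.swap) (simp add: sum_distrib_left)
  also have "\<dots> = of_int (\<delta> j * c p j)"
    using assms(4) by (simp add: UW c_def sum_distrib_left mult_ac)
  finally have eq: "(\<Sum>i<n. of_int (U j i) * act p 1 i) = of_int (\<delta> j * c p j)" .
  have "of_int (\<delta> j * c p j) / of_int k = (\<Sum>i<n. of_int (U j i) * (act p 1 i / of_int k))"
    unfolding eq[symmetric] by (simp add: sum_divide_distrib)
  also have "\<dots> \<in> \<int>"
    using assms(2) unfolding int_scale_std_lattice_iff[OF assms(3)] by (intro Ints_sum Ints_mult) auto
  finally obtain s where "of_int (\<delta> j * c p j) / of_int k = (of_int s :: rat)" by (rule Ints_cases)
  hence "(of_int (\<delta> j * c p j) :: rat) = of_int (k * s)" using assms(3) by (simp add: field_simps)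
  hence "\<delta> j * c p j = k * s" by (simp only: of_int_eq_iff)
  thus ?thesis by simp
qed

definition par :: "(nat \<Rightarrow> rat) \<Rightarrow> nat set" where
  "par z = {j \<in> {n - n div 2..<n}. y z j / 2 \<notin> \<int>}"

definition rel :: "int poly \<Rightarrow> nat set" where
  "rel p = {j \<in> {n - n div 2..<n}. odd (c p j)}"

lemma par_inj:
  assumes z: "z \<in> std_lattice n" "\<And>k. dot n z ((T ^^ k) 1) / 2 \<in> \<int>"
    and z': "z' \<in> std_lattice n" "\<And>k. dot n z' ((T ^^ k) 1) / 2 \<in> \<int>"
    and eq: "par z = par z'"
  shows "z - z' \<in> int_scale 2 ` std_lattice n"
proof -
  have "y (z - z') j / 2 \<in> \<int>" if j: "j < n" for j
  proof (cases "j < n - n div 2")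
    case True
    have "y z j / 2 \<in> \<int>" "y z' j / 2 \<in> \<int>"
      using \<delta>_y_divisible[OF j z(2)] \<delta>_y_divisible[OF j z'(2)] \<delta>_one[OF True] by simp_all
    thus ?thesis by (simp add: y_diff diff_divide_distrib)
  next
    case False
    obtain a where a: "y z j = of_int a" using y_Ints[OF z(1)] by (rule Ints_cases)
    obtain b where b: "y z' j = of_int b" using y_Ints[OF z'(1)] by (rule Ints_cases)
    note ab = a b
    have "j \<in> par z \<longleftrightarrow> j \<in> par z'" using eq by simp
    hence "even a \<longleftrightarrow> even b" using False j by (simp add: par_def ab half_Ints_iff_even)
    hence "even (a - b)" by simp
    moreover have "y (z - z') j = of_int (a - b)" by (simp add: y_diff ab)
    ultimately show ?thesis by (simp only: half_Ints_iff_even)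
  qed
  from divisible_by_coordinates[OF this] have "\<forall>i<n. (z - z') i / of_int 2 \<in> \<int>" by simp
  thus ?thesis by (simp only: int_scale_std_lattice_iff zero_neq_numeral[symmetric] not_False_eq_True)
qed

lemma c_even:
  assumes "degree p < n" "act p 1 \<in> int_scale 4 ` std_lattice n" "j < n - 1"
  shows "even (c p j)"
proof -
  have "4 dvd \<delta> j * c p j" 
    by (rule \<delta>_c_dvd[OF assms(1,2)]) (use assms(3) in simp_all)
  moreover have "\<delta> j * c p j dvd 2 * c p j" using \<delta>_two[OF assms(3)] by (intro mult_dvd_mono) auto
  ultimately have "4 dvd 2 * c p j" by (rule dvd_trans)
  thus ?thesis by presburger
qed

text \<open>By \<open>c_even\<close> all entries of \<open>c\<close> but the last are even, and the
  last is odd because the polynomial does not vanish modulo 2. So \<open>p\<close> and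
  \<open>q\<close> have the same parities.\<close>

lemma rel_four:
  assumes p: "degree p < n" "act p 1 \<in> int_scale 4 ` std_lattice n" "\<not> 2 dvd p"
    and q: "degree q < n" "act q 1 \<in> int_scale 4 ` std_lattice n" "\<not> 2 dvd q"
  shows "2 dvd p - q"
proof -
  have last: "odd (c r (n - 1))" if r: "degree r < n" "act r 1 \<in> int_scale 4 ` std_lattice n" "\<not> 2 dvd r" for r
  proof
    assume *: "even (c r (n - 1))"
    have "even (c r j)" if "j < n" for j
      using c_even[OF r(1,2), of j] * that by (cases "j = n - 1") auto
    hence "2 dvd r" by (rule two_dvd_if_c_even[OF r(1)])
    with r(3) show False by contradiction
  qed
  have "even (c (p - q) j)" if "j < n" for j
  proof (cases "j = n - 1")
    case True
    thus ?thesis using last[OF p] last[OF q] by (simp add: c_diff)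
  next
    case False
    hence "j < n - 1" using that by simp
    thus ?thesis using c_even[OF p(1,2)] c_even[OF q(1,2)] by (simp add: c_diff)
  qed
  thus ?thesis using p(1) q(1) by (intro two_dvd_if_c_even degree_diff_less)
qed

lemma rel_inj:
  assumes p: "degree p < n" "act p 1 \<in> int_scale 2 ` std_lattice n"
    and q: "degree q < n" "act q 1 \<in> int_scale 2 ` std_lattice n" and eq: "rel p = rel q"
  shows "2 dvd p - q"
proof -
  have "even (c (p - q) j)" if j: "j < n" for j
  proof (cases "j < n - n div 2")
    case True
    have "2 dvd \<delta> j * c p j" "2 dvd \<delta> j * c q j"
      by (rule \<delta>_c_dvd[OF p _ j] \<delta>_c_dvd[OF q _ j]; simp)+
    thus ?thesis by (simp add: c_diff \<delta>_one[OF True])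
  next
    case False
    have "j \<in> rel p \<longleftrightarrow> j \<in> rel q" using eq by simp
    thus ?thesis using False j by (simp add: rel_def c_diff)
  qed
  thus ?thesis using p(1) q(1) by (intro two_dvd_if_c_even degree_diff_less)
qed

text \<open>Before the last index \<open>\<delta> j\<close> divides 2, so doubling already makes the
  coordinate integral.\<close>

lemma psi_two:
  assumes x: "\<And>k. dot n x ((T ^^ k) 1) \<in> \<int>" and last: "y (int_scale 2 x) (n - 1) \<in> \<int>"
  shows "int_scale 2 x \<in> std_lattice n"
proof -
  have "y (int_scale 2 x) j / 1 \<in> \<int>" if j: "j < n" for j
  proof (cases "j = n - 1")
    case False
    hence "\<delta> j dvd 2" using j \<delta>_two by simp
    then obtain a where a: "2 = \<delta> j * a" by (rule dvdE)
    have "y (int_scale 2 x) j = of_int a * (of_int (\<delta> j) * y x j / 1)"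
      unfolding y_scale a by simp
    also have "\<dots> \<in> \<int>" using x by (intro Ints_mult Ints_of_int \<delta>_y_divisible[OF j]) simp
    finally show ?thesis by simp
  qed (use last in simp)
  from divisible_by_coordinates[OF this] show ?thesis by simp
qed

sublocale walk_lattice int_scale "dot n" T 1 "std_lattice n" n "\<lambda>x. y x (n - 1)" "\<delta> (n - 1)" par rel
proof
  show "self_adjoint_module.char_lattice (dot n) T 1 (std_lattice n)" by (rule std)
  show "2 \<le> n" by (rule n_ge_2)
  show "dot n 1 1 = of_nat n" by (simp add: dot_def)
  show "0 < \<delta> (n - 1)" using n_ge_2 by (intro \<delta>_pos) simp
  show "y (x + x') (n - 1) = y x (n - 1) + y x' (n - 1)" for x x' by (rule y_add)
  show "y (int_scale a x) (n - 1) = of_int a * y x (n - 1)" for a x by (rule y_scale)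
  show "of_int (\<delta> (n - 1)) * y x (n - 1) \<in> \<int>" if "\<And>j. dot n x ((T ^^ j) 1) \<in> \<int>" for x
    using \<delta>_y_divisible[of "n - 1" x 1] that n_ge_2 by simp
  show "int_scale 2 x \<in> std_lattice n"
    if "\<And>j. dot n x ((T ^^ j) 1) \<in> \<int>" "y (int_scale 2 x) (n - 1) \<in> \<int>" for x
    using that by (rule psi_two)
  show "y x (n - 1) \<in> \<int>" if "x \<in> std_lattice n" for x using that by (rule y_Ints)
  show "par z \<subseteq> {n - n div 2..<n}" for z by (auto simp: par_def)
  show "rel p \<subseteq> {n - n div 2..<n}" for p by (auto simp: rel_def)
  show "z - z' \<in> int_scale 2 ` std_lattice n"
    if "z \<in> std_lattice n" "z' \<in> std_lattice n" "\<And>j. dot n z ((T ^^ j) 1) / 2 \<in> \<int>"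
      "\<And>j. dot n z' ((T ^^ j) 1) / 2 \<in> \<int>" "par z = par z'" for z z'
    by (rule par_inj[OF that(1,3,2,4,5)])
  show "2 dvd p - q"
    if "degree p < n" "degree q < n" "act p 1 \<in> int_scale 2 ` std_lattice n"
      "act q 1 \<in> int_scale 2 ` std_lattice n" "rel p = rel q" for p q
    by (rule rel_inj[OF that(1,3,2,4,5)])
  show "2 dvd p - q"
    if "degree p < n" "degree q < n" "act p 1 \<in> int_scale 4 ` std_lattice n"
      "act q 1 \<in> int_scale 4 ` std_lattice n" "\<not> 2 dvd p" "\<not> 2 dvd q" for p q
    by (rule rel_four[OF that(1,3,5,2,4,6)])
qed

end

subsection \<open>Graphs and regular orthogonal matrices\<close>

lemma mult_mat_entry:
  "A \<in> carrier_mat n n \<Longrightarrow> B \<in> carrier_mat n n \<Longrightarrow> i < n \<Longrightarrow> j < n \<Longrightarrow>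
    (A * B) $$ (i, j) = (\<Sum>k<n. A $$ (i, k) * B $$ (k, j))"
  by (auto simp: scalar_prod_def atLeast0LessThan intro!: sum.cong)

lemma mult_mat_vec_entry:
  "A \<in> carrier_mat n n \<Longrightarrow> v \<in> carrier_vec n \<Longrightarrow> i < n \<Longrightarrow>
    (A *\<^sub>v v) $ i = (\<Sum>k<n. A $$ (i, k) * v $ k)"
  by (auto simp: scalar_prod_def atLeast0LessThan intro!: sum.cong)

lemma pow_mat_Suc_left:
  assumes A: "A \<in> carrier_mat n n"
  shows "A ^\<^sub>m Suc k = A * A ^\<^sub>m k"
proof (induction k)
  case 0
  show ?case using A by simp
next
  case (Suc k)
  have Ak: "A ^\<^sub>m k \<in> carrier_mat n n" using A by (rule pow_carrier_mat)
  have "A ^\<^sub>m Suc (Suc k) = A * A ^\<^sub>m k * A" using Suc.IH by simp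
  also have "\<dots> = A * (A ^\<^sub>m k * A)" using A Ak by (intro assoc_mult_mat) auto
  finally show ?case by simp
qed

lemma adjacency_mat_carrier: "num_verts G = n \<Longrightarrow> adjacency_mat G \<in> carrier_mat n n"
  by (auto simp: adjacency_mat_def)

lemma adjacency_mat_entry:
  "num_verts G = n \<Longrightarrow> i < n \<Longrightarrow> j < n \<Longrightarrow> adjacency_mat G $$ (i, j) = of_bool ((i, j) \<in> parcs G)"
  by (auto simp: adjacency_mat_def)

lemma simple_graph_sym:
  assumes "simple_graph G"
  shows "(u, v) \<in> parcs G \<longleftrightarrow> (v, u) \<in> parcs G"
proof -
  interpret pair_graph G using assms by (simp add: simple_graph_def)
  show ?thesis by (metis arcs_symmetric)
qed

lemma simple_graph_no_loop:
  assumes "simple_graph G"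
  shows "(u, u) \<notin> parcs G"
proof
  interpret pair_graph G using assms by (simp add: simple_graph_def)
  assume "(u, u) \<in> parcs G"
  from pair_no_loops[OF this] show False by simp
qed

lemma walk_mat_entry:
  assumes n: "num_verts G = n" and ik: "i < n" "k < n"
  shows "of_int (walk_mat G $$ (i, k)) = (lin n (\<lambda>i j. of_bool ((i, j) \<in> parcs G)) ^^ k) 1 i"
proof -
  let ?A = "adjacency_mat G :: int mat" and ?T = "lin n (\<lambda>i j. of_bool ((i, j) \<in> parcs G))"
  have A: "?A \<in> carrier_mat n n" by (rule adjacency_mat_carrier[OF n])
  have e: "all_ones n \<in> carrier_vec n" by (simp add: all_ones_def)
  have "\<forall>i<n. of_int ((?A ^\<^sub>m k *\<^sub>v all_ones n) $ i) = (?T ^^ k) 1 i" for k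
  proof (induction k)
    case 0
    show ?case using A by (simp add: all_ones_def)
  next
    case (Suc k)
    have Ak: "?A ^\<^sub>m k \<in> carrier_mat n n" using A by (rule pow_carrier_mat)
    show ?case
    proof (intro allI impI)
      fix i assume i: "i < n"
      have "?A ^\<^sub>m Suc k *\<^sub>v all_ones n = ?A *\<^sub>v (?A ^\<^sub>m k *\<^sub>v all_ones n)"
        unfolding pow_mat_Suc_left[OF A] using A Ak e by (rule assoc_mult_mat_vec)
      hence "(?A ^\<^sub>m Suc k *\<^sub>v all_ones n) $ i
          = (\<Sum>j<n. ?A $$ (i, j) * (?A ^\<^sub>m k *\<^sub>v all_ones n) $ j)"
        by (simp only: mult_mat_vec_entry[OF A mult_mat_vec_carrier[OF Ak e] i])
      hence "of_int ((?A ^\<^sub>m Suc k *\<^sub>v all_ones n) $ i)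
          = (\<Sum>j<n. of_int (?A $$ (i, j)) * of_int ((?A ^\<^sub>m k *\<^sub>v all_ones n) $ j))"
        by (simp only: of_int_sum of_int_mult)
      also have "\<dots> = (\<Sum>j<n. of_bool ((i, j) \<in> parcs G) * (?T ^^ k) 1 j)"
        by (intro sum.cong refl arg_cong2[where f = "(*)"])
          (simp_all only: lessThan_iff Suc.IH[rule_format] adjacency_mat_entry[OF n i] of_int_of_bool)
      finally show "of_int ((?A ^\<^sub>m Suc k *\<^sub>v all_ones n) $ i) = (?T ^^ Suc k) 1 i"
        by (simp add: lin_def)
    qed
  qed
  thus ?thesis using n ik by (simp add: walk_mat_def mat_of_cols_index)
qed

lemma invertible_mat_inverse:
  assumes "invertible_mat U" "U \<in> carrier_mat n n"
  obtains U' where "U' \<in> carrier_mat n n" "U * U' = 1\<^sub>m n" "U' * U = 1\<^sub>m n"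
proof -
  obtain U' where U': "U * U' = 1\<^sub>m (dim_row U)" "U' * U = 1\<^sub>m (dim_row U')"
    using assms(1) unfolding invertible_mat_def inverts_mat_def by blast
  have "dim_col U' = dim_row U" using arg_cong[OF U'(1), of dim_col] by simp
  moreover have "dim_row U' = dim_col U" using arg_cong[OF U'(2), of dim_col] by simp
  ultimately have "U' \<in> carrier_mat n n" using assms(2) by auto
  moreover from this have "U * U' = 1\<^sub>m n" "U' * U = 1\<^sub>m n" using U' assms(2) by auto
  ultimately show ?thesis by (rule that)
qed

lemma dvd_chain:
  fixes d :: "nat \<Rightarrow> int"
  assumes "\<forall>k\<in>{1..<n}. d k dvd d (Suc k)" "1 \<le> i" "i \<le> j" "j \<le> n"
  shows "d i dvd d j"
  using assms(3,4)
proof (induction j rule: dec_induct)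
  case (step j)
  have "d j dvd d (Suc j)" using assms(1,2) step by auto
  with step show ?case by (metis dvd_trans Suc_leD)
qed simp

lemma graph_family_smith_walk:
  assumes "G \<in> graph_family n"
  obtains W U U' V V' \<delta> where "smith_walk n (\<lambda>i j. of_bool ((i, j) \<in> parcs G)) W U U' V V' \<delta>"
proof -
  let ?A = "\<lambda>i j. of_bool ((i, j) \<in> parcs G)"
  from assms obtain d where G: "simple_graph G" "num_verts G = n" "2 \<le> n"
    and d: "invariant_factors n (walk_mat G) d" "d (nat \<lceil>real n / 2\<rceil>) = 1" "d (n - 1) = 2"
    by (auto simp: graph_family_def)
  from d(1) obtain U V where d': "walk_mat G \<in> carrier_mat n n" "\<forall>k\<in>{1..n}. 0 < d k"
      "\<forall>k\<in>{1..<n}. d k dvd d (Suc k)"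
    and U: "U \<in> carrier_mat n n" "invertible_mat U" and V: "V \<in> carrier_mat n n" "invertible_mat V"
    and UWV: "U * walk_mat G * V = mat_diag n (\<lambda>i. d (Suc i))"
    unfolding invariant_factors_def by blast
  define W where "W = walk_mat G"
  define D where "D = mat_diag n (\<lambda>i. d (Suc i))"
  have W: "W \<in> carrier_mat n n" using d'(1) by (simp add: W_def)
  have D: "D \<in> carrier_mat n n" by (simp add: D_def)
  have D_entry: "D $$ (i, j) = (if i = j then d (Suc j) else 0)" if "i < n" "j < n" for i j
    using that by (simp add: D_def mat_diag_def)
  obtain U' where U': "U' \<in> carrier_mat n n" "U * U' = 1\<^sub>m n" "U' * U = 1\<^sub>m n"
    using U(2,1) by (rule invertible_mat_inverse)
  obtain V' where V': "V' \<in> carrier_mat n n" "V * V' = 1\<^sub>m n" "V' * V = 1\<^sub>m n"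
    using V(2,1) by (rule invertible_mat_inverse)
  have UW_V: "U * (W * V) = D"
    using UWV U(1) V(1) W by (simp add: W_def D_def assoc_mult_mat[of _ n n _ n _ n])
  have "W * V = U' * U * (W * V)" using W V(1) by (simp add: U'(3))
  also have "\<dots> = U' * (U * (W * V))" using U'(1) U(1) W V(1) by (intro assoc_mult_mat) auto
  finally have WV: "W * V = U' * D" by (simp only: UW_V)
  have "U * W = U * W * (V * V')" using W U(1) by (simp add: V'(2))
  also have "\<dots> = U * W * V * V'" using U(1) W V(1) V'(1) by (intro assoc_mult_mat[symmetric]) auto
  finally have UW: "U * W = D * V'" using UWV by (simp add: W_def D_def)
  \<comment> \<open>The index at which the invariant factor is 1; divisibility then makes all
    earlier ones 1 as well.\<close>
  have ceil: "nat \<lceil>real n / 2\<rceil> = n - n div 2"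
  proof (cases "even n")
    case True
    then obtain k where "n = 2 * k" by (rule evenE)
    thus ?thesis by simp
  next
    case False
    then obtain k where k: "n = 2 * k + 1" by (rule oddE)
    have "\<lceil>real n / 2\<rceil> = int k + 1" by (rule ceiling_unique) (simp_all add: k field_simps)
    thus ?thesis by (simp add: k)
  qed
  have chain: "d i dvd d j" if "1 \<le> i" "i \<le> j" "j \<le> n" for i j
    using d'(3) that by (rule dvd_chain)
  \<comment> \<open>Invariant factors are numbered from 1 and matrix indices from 0, hence the shift
    \<open>d (Suc j)\<close>.\<close>
  have "smith_walk n ?A (\<lambda>i j. W $$ (i, j)) (\<lambda>i j. U $$ (i, j)) (\<lambda>i j. U' $$ (i, j))
      (\<lambda>i j. V $$ (i, j)) (\<lambda>i j. V' $$ (i, j)) (\<lambda>j. d (Suc j))"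
  proof
    show "2 \<le> n" by (rule G(3))
    show sym: "?A i j = (?A j i :: rat)" if "i < n" "j < n" for i j
      using simple_graph_sym[OF G(1), of i j] by simp
    show "self_adjoint_module.char_lattice (dot n) (lin n ?A) 1 (std_lattice n)"
      by (rule char_lattice_coordinates[where C = "\<lambda>i j. of_bool ((i, j) \<in> parcs G)"
            and q = "\<lambda>k l. of_bool (k = l)"])
        (use simple_graph_sym[OF G(1)] simple_graph_no_loop[OF G(1)] in \<open>auto simp: dot_def lin_def\<close>)
    show "of_int (W $$ (i, k)) = (lin n ?A ^^ k) 1 i" if "i < n" "k < n" for i k
      unfolding W_def using G(2) that by (rule walk_mat_entry)
    show "(\<Sum>k<n. W $$ (i, k) * V $$ (k, j)) = U' $$ (i, j) * d (Suc j)" if ij: "i < n" "j < n" for i j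
    proof -
      have "(\<Sum>k<n. W $$ (i, k) * V $$ (k, j)) = (U' * D) $$ (i, j)"
        using mult_mat_entry[OF W V(1) ij] by (simp add: WV)
      also have "\<dots> = (\<Sum>k<n. if k = j then U' $$ (i, k) * d (Suc j) else 0)"
        unfolding mult_mat_entry[OF U'(1) D ij] using ij by (intro sum.cong) (auto simp: D_entry)
      finally show ?thesis using ij by simp
    qed
    show "(\<Sum>i<n. U $$ (j, i) * W $$ (i, k)) = d (Suc j) * V' $$ (j, k)" if jk: "j < n" "k < n" for j k
    proof -
      have "(\<Sum>i<n. U $$ (j, i) * W $$ (i, k)) = (D * V') $$ (j, k)"
        using mult_mat_entry[OF U(1) W jk] by (simp add: UW)
      also have "\<dots> = (\<Sum>i<n. if j = i then d (Suc j) * V' $$ (i, k) else 0)"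
        unfolding mult_mat_entry[OF D V'(1) jk] using jk by (intro sum.cong) (auto simp: D_entry)
      finally show ?thesis using jk by simp
    qed
    show "(\<Sum>j<n. U' $$ (i, j) * U $$ (j, l)) = of_bool (i = l)" if "i < n" "l < n" for i l
      unfolding mult_mat_entry[OF U'(1) U(1) that, symmetric] U'(3) using that by simp
    show "(\<Sum>j<n. V $$ (k, j) * V' $$ (j, l)) = of_bool (k = l)" if "k < n" "l < n" for k l
      unfolding mult_mat_entry[OF V(1) V'(1) that, symmetric] V'(2) using that by simp
    show "0 < d (Suc j)" if "j < n" for j using d'(2) that by simp
    show "d (Suc j) = 1" if j: "j < n - n div 2" for j
    proof -
      have "d (Suc j) dvd 1" using chain[of "Suc j" "n - n div 2"] j d(2) by (simp add: ceil)
      moreover have "0 < d (Suc j)" using d'(2) j by simp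
      ultimately show ?thesis by simp
    qed
    show "d (Suc j) dvd 2" if "j < n - 1" for j
      using chain[of "Suc j" "n - 1"] that d(3) by simp
  qed
  thus ?thesis by (rule that)
qed

section \<open>The lattice spanned by the columns of a regular orthogonal matrix\<close>

definition column_coord :: "nat \<Rightarrow> rat mat \<Rightarrow> (nat \<Rightarrow> rat) \<Rightarrow> nat \<Rightarrow> rat" where
  "column_coord n Q x k = (\<Sum>i<n. Q $$ (i, k) * x i)"

definition column_lattice :: "nat \<Rightarrow> rat mat \<Rightarrow> (nat \<Rightarrow> rat) set" where
  "column_lattice n Q = {x. \<forall>k<n. column_coord n Q x k \<in> \<int>}"

lemma common_denominator:
  fixes S :: "rat set"
  assumes "finite S"
  shows "\<exists>d::int. 0 < d \<and> (\<forall>x\<in>S. of_int d * x \<in> \<int>)"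
  using assms
proof induction
  case empty
  show ?case by (intro exI[of _ 1]) simp
next
  case (insert x S)
  then obtain d :: int where d: "0 < d" "\<forall>x\<in>S. of_int d * x \<in> \<int>" by blast
  obtain a b where x: "x = of_int a / of_int b" "0 < b" by (metis quotient_of_div quotient_of_denom_pos surj_pair)
  have "of_int (b * d) * x = of_int (a * d)" using x by (simp add: field_simps)
  hence "of_int (b * d) * x \<in> \<int>" by (simp only: Ints_of_int)
  moreover have "of_int (b * d) * y = of_int b * (of_int d * y)" for y :: rat by simp
  hence "of_int (b * d) * y \<in> \<int>" if "y \<in> S" for y using d(2) that by (metis Ints_mult Ints_of_int)
  ultimately show ?case using d(1) x(2) by (intro exI[of _ "b * d"]) auto
qed

locale regular_orthogonal =
  fixes n :: nat and Q :: "rat mat"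
  assumes carrier: "Q \<in> carrier_mat n n" and orthonormal: "orthonormal_mat Q"
    and regular: "Q *\<^sub>v all_ones n = all_ones n"
begin

lemma QtQ: "transpose_mat Q * Q = 1\<^sub>m n"
  using orthonormal carrier by (simp add: orthonormal_mat_def)

lemma transpose_carrier: "transpose_mat Q \<in> carrier_mat n n"
  using carrier by simp

lemma QQt: "Q * transpose_mat Q = 1\<^sub>m n"
  using transpose_carrier carrier QtQ by (rule mat_mult_left_right_inverse)

lemma columns: "k < n \<Longrightarrow> l < n \<Longrightarrow> (\<Sum>i<n. Q $$ (i, k) * Q $$ (i, l)) = of_bool (k = l)"
  using arg_cong[OF QtQ, of "\<lambda>M. M $$ (k, l)"] carrier
  by (simp add: mult_mat_entry[OF transpose_carrier carrier] del: index_mult_mat)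

lemma rows: "i < n \<Longrightarrow> j < n \<Longrightarrow> (\<Sum>k<n. Q $$ (i, k) * Q $$ (j, k)) = of_bool (i = j)"
  using arg_cong[OF QQt, of "\<lambda>M. M $$ (i, j)"] carrier
  by (simp add: mult_mat_entry[OF carrier transpose_carrier] del: index_mult_mat)

lemma row_sum:
  assumes "i < n"
  shows "(\<Sum>k<n. Q $$ (i, k)) = 1"
proof -
  have "(Q *\<^sub>v all_ones n) $ i = (\<Sum>k<n. Q $$ (i, k) * all_ones n $ k)"
    using carrier assms by (intro mult_mat_vec_entry) (simp_all add: all_ones_def)
  thus ?thesis using assms by (simp add: regular) (simp add: all_ones_def)
qed

lemma coord_inverse:
  assumes "i < n"
  shows "(\<Sum>k<n. Q $$ (i, k) * column_coord n Q x k) = x i"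
proof -
  have "(\<Sum>k<n. Q $$ (i, k) * column_coord n Q x k)
      = (\<Sum>j<n. (\<Sum>k<n. Q $$ (i, k) * Q $$ (j, k)) * x j)"
    unfolding column_coord_def sum_distrib_left sum_distrib_right
    by (subst sum.swap) (simp add: mult_ac)
  also have "\<dots> = (\<Sum>j<n. of_bool (i = j) * x j)"
    using assms by (intro sum.cong) (auto simp: rows)
  also have "\<dots> = x i" using assms by (intro sum_of_bool_mult_left) auto
  finally show ?thesis .
qed

text \<open>Apply the transpose of \<open>Q\<close> to the equation that \<open>Q\<close> fixes the
  all-ones vector.\<close>

lemma column_sum:
  assumes "k < n"
  shows "(\<Sum>i<n. Q $$ (i, k)) = 1"
proof -
  have "(\<Sum>i<n. Q $$ (i, k)) = (\<Sum>i<n. Q $$ (i, k) * (\<Sum>l<n. Q $$ (i, l)))"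
    by (intro sum.cong) (auto simp: row_sum)
  also have "\<dots> = (\<Sum>l<n. \<Sum>i<n. Q $$ (i, k) * Q $$ (i, l))"
    unfolding sum_distrib_left by (rule sum.swap)
  also have "\<dots> = (\<Sum>l<n. of_bool (k = l) * 1)"
    using assms by (intro sum.cong) (auto simp: columns)
  also have "\<dots> = 1" using assms by (intro sum_of_bool_mult_left) auto
  finally show ?thesis .
qed

lemma isometry: "dot n x x' = (\<Sum>k<n. column_coord n Q x k * column_coord n Q x' k)"
proof -
  have "(\<Sum>k<n. column_coord n Q x k * column_coord n Q x' k)
      = (\<Sum>k<n. \<Sum>i<n. x i * (Q $$ (i, k) * column_coord n Q x' k))"
    unfolding column_coord_def[of n Q x] sum_distrib_right by (simp add: mult_ac)
  also have "\<dots> = (\<Sum>i<n. x i * (\<Sum>k<n. Q $$ (i, k) * column_coord n Q x' k))"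
    unfolding sum_distrib_left by (rule sum.swap)
  also have "\<dots> = dot n x x'" by (simp add: coord_inverse dot_def)
  finally show ?thesis ..
qed

lemma column_mem: "k < n \<Longrightarrow> (\<lambda>i. Q $$ (i, k)) \<in> column_lattice n Q"
  by (simp add: column_lattice_def column_coord_def columns)

text \<open>In the coordinates given by the columns of \<open>Q\<close>, the adjacency matrix of
  \<open>G\<close> becomes that of \<open>H\<close>, which is integral, symmetric and has zero
  diagonal.\<close>

lemma char_lattice_column_lattice:
  assumes A: "num_verts G = n" "simple_graph G" and H: "num_verts H = n" "simple_graph H"
    and QAQ: "transpose_mat Q * adjacency_mat G * Q = adjacency_mat H"
  shows "self_adjoint_module.char_lattice (dot n) (lin n (\<lambda>i j. of_bool ((i, j) \<in> parcs G))) 1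
    (column_lattice n Q)"
  unfolding column_lattice_def
proof (rule char_lattice_coordinates[where C = "\<lambda>i j. of_bool ((i, j) \<in> parcs H)"
      and q = "\<lambda>k i. Q $$ (i, k)"])
  fix x k assume k: "k < n"
  let ?A = "adjacency_mat G :: rat mat" and ?C = "adjacency_mat H :: rat mat"
  have Am: "?A \<in> carrier_mat n n" and Cm: "?C \<in> carrier_mat n n"
    using A H by (auto intro: adjacency_mat_carrier)
  have "transpose_mat Q * ?A = transpose_mat Q * ?A * (Q * transpose_mat Q)"
    using transpose_carrier Am by (simp add: QQt)
  also have "\<dots> = ?C * transpose_mat Q"
    unfolding QAQ[symmetric] using transpose_carrier Am carrier
    by (intro assoc_mult_mat[symmetric]) auto
  finally have eq: "transpose_mat Q * ?A = ?C * transpose_mat Q" .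
  have entry: "(\<Sum>i<n. Q $$ (i, k) * of_bool ((i, j) \<in> parcs G))
      = (\<Sum>l<n. of_bool ((k, l) \<in> parcs H) * Q $$ (j, l))" if j: "j < n" for j
    using arg_cong[OF eq, of "\<lambda>M. M $$ (k, j)"] carrier k j
    by (simp add: mult_mat_entry[OF transpose_carrier Am k j] mult_mat_entry[OF Cm transpose_carrier k j]
        adjacency_mat_entry[OF A(1)] adjacency_mat_entry[OF H(1)] del: index_mult_mat)
  have "column_coord n Q (lin n (\<lambda>i j. of_bool ((i, j) \<in> parcs G)) x) k
      = (\<Sum>i<n. \<Sum>j<n. Q $$ (i, k) * of_bool ((i, j) \<in> parcs G) * x j)"
    by (simp only: column_coord_def lin_def sum_distrib_left mult.assoc)
  also have "\<dots> = (\<Sum>j<n. (\<Sum>i<n. Q $$ (i, k) * of_bool ((i, j) \<in> parcs G)) * x j)"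
    unfolding sum_distrib_right by (rule sum.swap)
  also have "\<dots> = (\<Sum>j<n. \<Sum>l<n. of_bool ((k, l) \<in> parcs H) * Q $$ (j, l) * x j)"
    unfolding sum_distrib_right[symmetric] by (intro sum.cong refl) (simp only: entry lessThan_iff)
  also have "\<dots> = (\<Sum>l<n. of_bool ((k, l) \<in> parcs H) * column_coord n Q x l)"
    unfolding column_coord_def sum_distrib_left by (subst sum.swap) (simp add: mult.assoc)
  finally show "column_coord n Q (lin n (\<lambda>i j. of_bool ((i, j) \<in> parcs G)) x) k
      = (\<Sum>l<n. of_int (of_bool ((k, l) \<in> parcs H)) * column_coord n Q x l)"
    by simp
qed (use simple_graph_sym[OF A(2)] simple_graph_sym[OF H(2)] simple_graph_no_loop[OF H(2)] column_sum
    isometry columns in \<open>auto simp: column_coord_def\<close>)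

lemma scale_column_lattice_iff:
  "(\<forall>x\<in>column_lattice n Q. int_scale k x \<in> std_lattice n) \<longleftrightarrow>
    (\<forall>i<n. \<forall>j<n. of_int k * Q $$ (i, j) \<in> \<int>)"
proof
  assume *: "\<forall>x\<in>column_lattice n Q. int_scale k x \<in> std_lattice n"
  show "\<forall>i<n. \<forall>j<n. of_int k * Q $$ (i, j) \<in> \<int>"
    using bspec[OF * column_mem] by (simp add: int_scale_def)
next
  assume *: "\<forall>i<n. \<forall>j<n. of_int k * Q $$ (i, j) \<in> \<int>"
  show "\<forall>x\<in>column_lattice n Q. int_scale k x \<in> std_lattice n"
  proof
    fix x assume x: "x \<in> column_lattice n Q"
    have "of_int k * x i \<in> \<int>" if i: "i < n" for i
    proof -
      have "of_int k * x i = (\<Sum>j<n. of_int k * Q $$ (i, j) * column_coord n Q x j)"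
        by (simp add: coord_inverse[OF i, of x, symmetric] sum_distrib_left mult.assoc)
      also have "\<dots> \<in> \<int>"
        using * x i by (intro Ints_sum Ints_mult[of "of_int k * _"]) (auto simp: column_lattice_def)
      finally show ?thesis .
    qed
    thus "int_scale k x \<in> std_lattice n" by (simp add: int_scale_def)
  qed
qed

text \<open>The integers \<open>k\<close> for which \<open>k\<close> times \<open>Q\<close> is
  integral form a nonzero ideal, which is generated by its least positive member.\<close>

lemma level_dvd_iff:
  "0 < level Q"
  "(\<forall>i<n. \<forall>j<n. of_int k * Q $$ (i, j) \<in> \<int>) \<longleftrightarrow> int (level Q) dvd k"
proof -
  define K where "K = {k::int. \<forall>i<n. \<forall>j<n. of_int k * Q $$ (i, j) \<in> \<int>}"
  obtain d :: int where "0 < d" "\<forall>x\<in>(\<lambda>(i, j). Q $$ (i, j)) ` ({..<n} \<times> {..<n}). of_int d * x \<in> \<int>"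
    using common_denominator[of "(\<lambda>(i, j). Q $$ (i, j)) ` ({..<n} \<times> {..<n})"] by auto
  hence d: "0 < d" "d \<in> K" by (auto simp: K_def)
  obtain r where r: "r \<in> K" "0 < r" "\<And>x. x \<in> K \<Longrightarrow> r dvd x"
    using int_subgroup_generator[of K d] d
    by (auto simp: K_def distrib_right mult.assoc intro: Ints_add Ints_mult)
  have elements: "elements_mat (of_nat x \<cdot>\<^sub>m Q) \<subseteq> \<int> \<longleftrightarrow> int x \<in> K" for x
    using carrier by (auto simp: K_def elements_mat_def UN_subset_iff image_subset_iff)
  have "level Q = nat r"
    unfolding level_def elements
  proof (rule Least_equality)
    show "0 < nat r \<and> int (nat r) \<in> K" using r by simp
    show "nat r \<le> x" if "0 < x \<and> int x \<in> K" for x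
      using r(3)[of "int x"] that zdvd_imp_le[of r "int x"] by simp
  qed
  hence level: "int (level Q) = r" using r(2) by simp
  show "0 < level Q" using level r(2) by simp
  show "(\<forall>i<n. \<forall>j<n. of_int k * Q $$ (i, j) \<in> \<int>) \<longleftrightarrow> int (level Q) dvd k"
  proof
    assume "int (level Q) dvd k"
    then obtain s where s: "k = r * s" unfolding level by (rule dvdE)
    have "of_int k * Q $$ (i, j) \<in> \<int>" if "i < n" "j < n" for i j
    proof -
      have "of_int k * Q $$ (i, j) = of_int s * (of_int r * Q $$ (i, j))" by (simp add: s)
      moreover have "of_int r * Q $$ (i, j) \<in> \<int>" using r(1) that by (simp add: K_def)
      ultimately show ?thesis using Ints_mult[OF Ints_of_int] by metis
    qed
    thus "\<forall>i<n. \<forall>j<n. of_int k * Q $$ (i, j) \<in> \<int>" by blast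
  qed (use r(3) level in \<open>simp add: K_def\<close>)
qed

end

text \<open>In each row the sum of \<open>P i k * (P i k - 1)\<close> is 0 with nonnegative terms,
  so the entries are 0 or 1, and the row sum leaves exactly one 1. Orthogonality of the rows puts
  these in different columns.\<close>

lemma integral_regular_orthogonal_imp_permutation:
  fixes P :: "nat \<Rightarrow> nat \<Rightarrow> int"
  assumes rows: "\<And>i j. i < n \<Longrightarrow> j < n \<Longrightarrow> (\<Sum>k<n. P i k * P j k) = of_bool (i = j)"
    and row_sum: "\<And>i. i < n \<Longrightarrow> (\<Sum>k<n. P i k) = 1"
  obtains \<pi> where "bij_betw \<pi> {..<n} {..<n}" "\<And>i k. i < n \<Longrightarrow> k < n \<Longrightarrow> P i k = of_bool (k = \<pi> i)"
proof -
  have zero_one: "P i k = 0 \<or> P i k = 1" if ik: "i < n" "k < n" for i k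
  proof -
    have "(\<Sum>k<n. P i k * (P i k - 1)) = 0"
      using rows[OF ik(1) ik(1)] row_sum[OF ik(1)] by (simp add: right_diff_distrib sum_subtractf)
    moreover have nonneg: "0 \<le> x * (x - 1)" for x :: int
      by (cases "x \<le> 0") (auto simp: mult_nonpos_nonpos)
    ultimately have "P i k * (P i k - 1) = 0"
      using sum_nonneg_eq_0_iff[of "{..<n}" "\<lambda>k. P i k * (P i k - 1)"] ik(2) by simp
    thus ?thesis by simp
  qed
  have "\<exists>l<n. \<forall>k<n. P i k = of_bool (k = l)" if i: "i < n" for i
  proof -
    have "(\<Sum>k<n. P i k) = (\<Sum>k<n. of_bool (P i k = 1))"
      using zero_one[OF i] by (intro sum.cong) auto
    also have "\<dots> = int (card {k \<in> {..<n}. P i k = 1})" by (simp add: sum_of_bool_eq Int_def)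
    finally have "card {k \<in> {..<n}. P i k = 1} = 1" using row_sum[OF i] by simp
    then obtain l where l: "{k \<in> {..<n}. P i k = 1} = {l}" by (rule card_1_singletonE)
    have "P i k = of_bool (k = l)" if k: "k < n" for k
    proof (cases "P i k = 1")
      case True
      hence "k \<in> {k \<in> {..<n}. P i k = 1}" using k by simp
      thus ?thesis using True unfolding l by simp
    next
      case False
      hence "k \<noteq> l" using l by auto
      thus ?thesis using False zero_one[OF i k] by simp
    qed
    moreover have "l < n" using l by auto
    ultimately show ?thesis by blast
  qed
  then obtain \<pi> where \<pi>: "\<And>i. i < n \<Longrightarrow> \<pi> i < n" "\<And>i k. i < n \<Longrightarrow> k < n \<Longrightarrow> P i k = of_bool (k = \<pi> i)"
    by metis
  have "inj_on \<pi> {..<n}"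
  proof (rule inj_onI)
    fix i j assume ij: "i \<in> {..<n}" "j \<in> {..<n}" "\<pi> i = \<pi> j"
    have "(\<Sum>k<n. P i k * P j k) = (\<Sum>k<n. of_bool (\<pi> i = k) * 1)"
      using ij \<pi>(2) by (intro sum.cong) auto
    also have "\<dots> = 1" using ij \<pi>(1) by (intro sum_of_bool_mult_left) auto
    finally show "i = j" using rows[of i j] ij by (simp split: if_splits)
  qed
  hence "bij_betw \<pi> {..<n} {..<n}"
    using \<pi>(1) by (intro bij_betw_imageI endo_inj_surj) auto
  thus ?thesis using \<pi>(2) by (rule that)
qed

lemma digraph_iso_with_projI:
  assumes wf: "wf_digraph (with_proj G)"
    and bij: "bij_betw f (pverts G) (pverts H)"
    and arcs: "\<And>u v. u \<in> pverts G \<Longrightarrow> v \<in> pverts G \<Longrightarrow> (u, v) \<in> parcs G \<longleftrightarrow> (f u, f v) \<in> parcs H"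
    and H: "parcs H \<subseteq> pverts H \<times> pverts H"
  shows "digraph_iso (with_proj G) (with_proj H)"
  unfolding digraph_iso_def
proof (intro exI conjI)
  let ?f = "\<lparr>iso_verts = f, iso_arcs = map_prod f f, iso_head = snd, iso_tail = fst\<rparr>"
  have G: "parcs G \<subseteq> pverts G \<times> pverts G"
    using wf_digraph.tail_in_verts[OF wf] wf_digraph.head_in_verts[OF wf] by fastforce
  have inj: "inj_on f (pverts G)" and img: "f ` pverts G = pverts H"
    using bij by (auto simp: bij_betw_def)
  have "inj_on (map_prod f f) (parcs G)"
    using map_prod_inj_on[OF inj inj] G by (rule inj_on_subset)
  with wf inj show "pre_digraph.digraph_isomorphism (with_proj G) ?f"
    by (auto simp: pre_digraph.digraph_isomorphism_def)
  have "map_prod f f ` parcs G = parcs H"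
  proof
    show "map_prod f f ` parcs G \<subseteq> parcs H"
    proof
      fix a assume "a \<in> map_prod f f ` parcs G"
      then obtain u v where uv: "(u, v) \<in> parcs G" "a = (f u, f v)" by auto
      hence "u \<in> pverts G" "v \<in> pverts G" using G by auto
      thus "a \<in> parcs H" using uv arcs by simp
    qed
    show "parcs H \<subseteq> map_prod f f ` parcs G"
    proof
      fix a assume a: "a \<in> parcs H"
      obtain x y where xy: "a = (x, y)" by (cases a)
      have "x \<in> f ` pverts G" "y \<in> f ` pverts G" using a H img by (auto simp: xy)
      then obtain u v where uv: "u \<in> pverts G" "v \<in> pverts G" "x = f u" "y = f v" by auto
      hence "(u, v) \<in> parcs G" using a arcs by (simp add: xy)
      thus "a \<in> map_prod f f ` parcs G" by (intro image_eqI[of _ _ "(u, v)"]) (simp_all add: xy uv)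
    qed
  qed
  thus "with_proj H = app_iso ?f (with_proj G)"
    using img by (simp add: app_iso_def with_proj_def)
qed

theorem theorem1p1:
  fixes n :: nat
    and G H1 H2 :: "nat pair_pre_digraph"
    and Q1 Q2 :: "rat mat"
  assumes "G \<in> graph_family n"
    and "simple_graph H1" and "generalized_cospectral H1 G"
    and "simple_graph H2" and "generalized_cospectral H2 G"
    and "Q1 \<in> carrier_mat n n" and "orthonormal_mat Q1"
    and "transpose_mat Q1 * adjacency_mat G * Q1 = adjacency_mat H1"
    and "Q1 *\<^sub>v all_ones n = all_ones n"
    and "Q2 \<in> carrier_mat n n" and "orthonormal_mat Q2"
    and "transpose_mat Q2 * adjacency_mat G * Q2 = adjacency_mat H2"
    and "Q2 *\<^sub>v all_ones n = all_ones n"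
    and "level Q1 = level Q2"
  shows "digraph_iso (with_proj H1) (with_proj H2)"
proof -
  interpret Q1: regular_orthogonal n Q1 by unfold_locales (fact assms)+
  interpret Q2: regular_orthogonal n Q2 by unfold_locales (fact assms)+
  have G: "simple_graph G" "num_verts G = n" using assms(1) by (auto simp: graph_family_def)
  \<comment> \<open>The number of vertices is read off from the size of the matrix product.\<close>
  have "dim_row (adjacency_mat H1 :: rat mat) = n"
    unfolding assms(8)[symmetric] using assms(6) by simp
  hence H1: "num_verts H1 = n" by (simp add: adjacency_mat_def)
  have "dim_row (adjacency_mat H2 :: rat mat) = n"
    unfolding assms(12)[symmetric] using assms(10) by simp
  hence H2: "num_verts H2 = n" by (simp add: adjacency_mat_def)
  obtain W U U' V V' \<delta> where "smith_walk n (\<lambda>i j. of_bool ((i, j) \<in> parcs G)) W U U' V V' \<delta>"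
    using assms(1) by (rule graph_family_smith_walk)
  then interpret smith_walk n "\<lambda>i j. of_bool ((i, j) \<in> parcs G)" W U U' V V' \<delta> .
  have "has_level (column_lattice n Q1) (int (level Q1))"
    unfolding has_level_def Q1.scale_column_lattice_iff using Q1.level_dvd_iff by simp
  moreover have "has_level (column_lattice n Q2) (int (level Q1))"
    unfolding has_level_def Q2.scale_column_lattice_iff using Q2.level_dvd_iff assms(14) by simp
  ultimately have subset: "column_lattice n Q2 \<subseteq> column_lattice n Q1"
    by (intro lattice_subset Q1.char_lattice_column_lattice[OF G(2,1) H1 assms(2,8)]
        Q2.char_lattice_column_lattice[OF G(2,1) H2 assms(4,12)])
  define P where "P = transpose_mat Q1 * Q2"
  note Q1t = Q1.transpose_carrier and Q2t = Q2.transpose_carrier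
  have P: "P \<in> carrier_mat n n" unfolding P_def using Q1t assms(10) by simp
  have P_entry: "P $$ (k, l) = column_coord n Q1 (\<lambda>i. Q2 $$ (i, l)) k" if "k < n" "l < n" for k l
    using that assms(6) unfolding P_def mult_mat_entry[OF Q1t assms(10) that] column_coord_def
    by (intro sum.cong) auto
  \<comment> \<open>The columns of \<open>Q2\<close> lie in the lattice of \<open>Q1\<close>, and
    their coordinates there are the entries of \<open>P\<close>.\<close>
  have "P $$ (k, l) \<in> \<int>" if "k < n" "l < n" for k l
    using subset Q2.column_mem[OF that(2)] that by (auto simp: P_entry column_lattice_def)
  hence P_floor: "P $$ (k, l) = of_int \<lfloor>P $$ (k, l)\<rfloor>" if "k < n" "l < n" for k l
    using that by simp
  have Pt: "transpose_mat P = transpose_mat Q2 * Q1"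
    unfolding P_def using Q1t assms(6,10) by (simp add: transpose_mult[of _ n n _ n])
  have Pt_carrier: "transpose_mat P \<in> carrier_mat n n" using P by simp
  have cancel: "Q1 * (transpose_mat Q1 * M) = M" "Q2 * (transpose_mat Q2 * M) = M"
    "transpose_mat Q1 * (Q1 * M) = M" "transpose_mat Q2 * (Q2 * M) = M" if "M \<in> carrier_mat n n" for M
    using that assms(6,10) Q1t Q2t
    by (simp_all add: assoc_mult_mat[symmetric, of _ n n _ n _ n] Q1.QQt Q2.QQt Q1.QtQ Q2.QtQ)
  have PPt: "P * transpose_mat P = 1\<^sub>m n"
    unfolding Pt unfolding P_def using assms(6,10) Q1t Q2t
    by (simp add: assoc_mult_mat[of _ n n _ n _ n] cancel Q1.QtQ)
  have rows: "(\<Sum>l<n. P $$ (i, l) * P $$ (j, l)) = of_bool (i = j)" if ij: "i < n" "j < n" for i j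
  proof -
    have "(\<Sum>l<n. P $$ (i, l) * P $$ (j, l)) = (P * transpose_mat P) $$ (i, j)"
      unfolding mult_mat_entry[OF P Pt_carrier ij] using P ij by (intro sum.cong) auto
    also have "\<dots> = of_bool (i = j)" unfolding PPt using ij by simp
    finally show ?thesis .
  qed
  have row_sum: "(\<Sum>l<n. P $$ (k, l)) = 1" if k: "k < n" for k
  proof -
    have "(\<Sum>l<n. P $$ (k, l)) = (\<Sum>l<n. \<Sum>i<n. Q1 $$ (i, k) * Q2 $$ (i, l))"
      using k by (simp add: P_entry column_coord_def)
    also have "\<dots> = (\<Sum>i<n. Q1 $$ (i, k) * (\<Sum>l<n. Q2 $$ (i, l)))"
      unfolding sum_distrib_left by (rule sum.swap)
    finally show ?thesis using k by (simp add: Q2.row_sum Q1.column_sum)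
  qed
  obtain \<pi> where \<pi>: "bij_betw \<pi> {..<n} {..<n}"
    "\<And>i k. i < n \<Longrightarrow> k < n \<Longrightarrow> \<lfloor>P $$ (i, k)\<rfloor> = of_bool (k = \<pi> i)"
  proof (rule integral_regular_orthogonal_imp_permutation[of n "\<lambda>i k. \<lfloor>P $$ (i, k)\<rfloor>"])
    fix i j assume ij: "i < n" "j < n"
    have "(of_int (\<Sum>k<n. \<lfloor>P $$ (i, k)\<rfloor> * \<lfloor>P $$ (j, k)\<rfloor>) :: rat) = (\<Sum>k<n. P $$ (i, k) * P $$ (j, k))"
      unfolding of_int_sum of_int_mult using ij
      by (intro sum.cong refl) (simp only: P_floor[symmetric] lessThan_iff)
    also have "\<dots> = of_int (of_bool (i = j))" using rows[OF ij] by simp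
    finally show "(\<Sum>k<n. \<lfloor>P $$ (i, k)\<rfloor> * \<lfloor>P $$ (j, k)\<rfloor>) = of_bool (i = j)"
      by (simp only: of_int_eq_iff)
  next
    fix i assume i: "i < n"
    have "(of_int (\<Sum>k<n. \<lfloor>P $$ (i, k)\<rfloor>) :: rat) = (\<Sum>k<n. P $$ (i, k))"
      unfolding of_int_sum using i
      by (intro sum.cong refl) (simp only: P_floor[symmetric] lessThan_iff)
    also have "\<dots> = of_int 1" using row_sum[OF i] by simp
    finally show "(\<Sum>k<n. \<lfloor>P $$ (i, k)\<rfloor>) = 1" by (simp only: of_int_eq_iff)
  qed (rule that)
  have P_perm: "P $$ (i, k) = of_bool (\<pi> i = k)" if "i < n" "k < n" for i k
    using P_floor[OF that] \<pi>(2)[OF that] by auto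
  let ?A = "adjacency_mat G :: rat mat" and ?C1 = "adjacency_mat H1 :: rat mat"
    and ?C2 = "adjacency_mat H2 :: rat mat"
  have C: "?A \<in> carrier_mat n n" "?C2 \<in> carrier_mat n n"
    using G H2 by (auto intro: adjacency_mat_carrier)
  \<comment> \<open>Both adjacency matrices are conjugates of that of \<open>G\<close>, so the
    permutation matrix \<open>P\<close> conjugates one into the other.\<close>
  have C1: "P * (?C2 * transpose_mat P) = ?C1"
    unfolding Pt assms(8,12)[symmetric] unfolding P_def using assms(6,10) Q1t Q2t C
    by (simp add: assoc_mult_mat[of _ n n _ n _ n] cancel)
  have arcs: "(i, j) \<in> parcs H1 \<longleftrightarrow> (\<pi> i, \<pi> j) \<in> parcs H2" if ij: "i < n" "j < n" for i j
  proof -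
    have \<pi>_less: "\<pi> i < n" "\<pi> j < n" using \<pi>(1) ij by (auto dest: bij_betwE)
    have C2P: "?C2 * transpose_mat P \<in> carrier_mat n n" using C Pt_carrier by simp
    have "?C1 $$ (i, j) = (\<Sum>k<n. of_bool (\<pi> i = k) * (?C2 * transpose_mat P) $$ (k, j))"
      unfolding C1[symmetric] mult_mat_entry[OF P C2P ij] using ij
      by (intro sum.cong) (auto simp: P_perm)
    also have "\<dots> = (?C2 * transpose_mat P) $$ (\<pi> i, j)"
      using \<pi>_less by (intro sum_of_bool_mult_left) auto
    also have "\<dots> = (\<Sum>k<n. of_bool (\<pi> j = k) * ?C2 $$ (\<pi> i, k))"
      unfolding mult_mat_entry[OF C(2) Pt_carrier \<pi>_less(1) ij(2)] using ij P
      by (intro sum.cong) (auto simp: P_perm)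
    also have "\<dots> = ?C2 $$ (\<pi> i, \<pi> j)"
      using \<pi>_less by (intro sum_of_bool_mult_left) auto
    finally show ?thesis
      using ij \<pi>_less by (simp add: adjacency_mat_entry[OF H1] adjacency_mat_entry[OF H2] of_bool_eq_iff)
  qed
  have verts: "pverts H1 = {..<n}" "pverts H2 = {..<n}"
    using assms(2,4) H1 H2 by (auto simp: simple_graph_def)
  interpret H1: pair_graph H1 using assms(2) by (simp add: simple_graph_def)
  interpret H2: pair_graph H2 using assms(4) by (simp add: simple_graph_def)
  show ?thesis
  proof (rule digraph_iso_with_projI)
    show "wf_digraph (with_proj H1)" by unfold_locales
    show "bij_betw \<pi> (pverts H1) (pverts H2)" using \<pi>(1) by (simp add: verts)
    show "(u, v) \<in> parcs H1 \<longleftrightarrow> (\<pi> u, \<pi> v) \<in> parcs H2" if "u \<in> pverts H1" "v \<in> pverts H1" for u v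
      using that arcs by (simp add: verts)
    show "parcs H2 \<subseteq> pverts H2 \<times> pverts H2"
      using H2.in_arcsD1 H2.in_arcsD2 by auto
  qed
qed

end
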